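(* Let $\Gamma$ be a distance-regular graph with classical parameters $(D,b,\alpha,\beta)$ such that $b\ge 2$ and $D\ge 3$. Let $r=[D]$. If $$\beta \geq \max\left\{\tfrac{2b+4}{2b+3}\,r\,(b+2)(\alpha b+b+\alpha),\ \tfrac{2b+4}{2b+3}\,r\,\big((b+1)(b^2+b+2)-3\big)\right\},$$ then $\Gamma$ is geometric.
   Context: Distance-regular graph with intersection numbers $b_i,c_i$, valency $k=b_0$. For integer $b\ne1$, $[j]=\frac{b^j-1}{b-1}$. Classical parameters $(D,b,\alpha,\beta)$: diameter $D$, $b_i=([D]-[i])(\beta-\alpha[i])$ ($0\le i\le D-1$), $c_i=[i](1+\alpha[i-1])$ ($1\le i\le D$). A Delsarte clique is a clique with $1+\frac{k}{-\theta_{\min}}$ vertices, $\theta_{\min}$ the smallest adjacency eigenvalue; $\Gamma$ is geometric if there is a set of Delsarte cliques such that every edge lies in exactly one of them. *)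

theory Defs
  imports Main "HOL-Library.Extended_Nat" Complex_Main
begin

definition simple_graph :: "'a set \<Rightarrow> ('a \<Rightarrow> 'a \<Rightarrow> bool) \<Rightarrow> bool" where
  "simple_graph V E \<longleftrightarrow> finite V \<and> (\<forall>x y. E x y \<longrightarrow> E y x) \<and> (\<forall>x. \<not> E x x)"

definition adj :: "'a set \<Rightarrow> ('a \<Rightarrow> 'a \<Rightarrow> bool) \<Rightarrow> 'a \<Rightarrow> 'a \<Rightarrow> bool" where
  "adj V E x y \<longleftrightarrow> x \<in> V \<and> y \<in> V \<and> E x y"

definition edge_rel :: "'a set \<Rightarrow> ('a \<Rightarrow> 'a \<Rightarrow> bool) \<Rightarrow> ('a \<times> 'a) set" where
  "edge_rel V E = {(x, y). adj V E x y}"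

definition nbr :: "'a set \<Rightarrow> ('a \<Rightarrow> 'a \<Rightarrow> bool) \<Rightarrow> 'a \<Rightarrow> 'a set" where
  "nbr V E x = {y \<in> V. E x y}"

definition gdist :: "'a set \<Rightarrow> ('a \<Rightarrow> 'a \<Rightarrow> bool) \<Rightarrow> 'a \<Rightarrow> 'a \<Rightarrow> nat" where
  "gdist V E x y = (LEAST n. (x, y) \<in> (edge_rel V E) ^^ n)"

definition connected_graph :: "'a set \<Rightarrow> ('a \<Rightarrow> 'a \<Rightarrow> bool) \<Rightarrow> bool" where
  "connected_graph V E \<longleftrightarrow> (\<forall>x\<in>V. \<forall>y\<in>V. \<exists>n. (x, y) \<in> (edge_rel V E) ^^ n)"

definition diameter :: "'a set \<Rightarrow> ('a \<Rightarrow> 'a \<Rightarrow> bool) \<Rightarrow> nat" where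
  "diameter V E = Max {gdist V E x y | x y. x \<in> V \<and> y \<in> V}"

definition distance_regular ::
  "'a set \<Rightarrow> ('a \<Rightarrow> 'a \<Rightarrow> bool) \<Rightarrow> nat \<Rightarrow> (nat \<Rightarrow> nat) \<Rightarrow> (nat \<Rightarrow> nat) \<Rightarrow> bool" where
  "distance_regular V E D bs cs \<longleftrightarrow>
     simple_graph V E \<and> V \<noteq> {} \<and> connected_graph V E \<and> diameter V E = D \<and>
     (\<forall>x\<in>V. \<forall>y\<in>V.
        card {z \<in> nbr V E y. gdist V E x z = gdist V E x y + 1} = bs (gdist V E x y) \<and>
        (gdist V E x y \<ge> 1 \<longrightarrow>
           card {z \<in> nbr V E y. gdist V E x z = gdist V E x y - 1} = cs (gdist V E x y)))"

definition qint :: "int \<Rightarrow> nat \<Rightarrow> real" where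
  "qint b j = (real_of_int b ^ j - 1) / (real_of_int b - 1)"

definition classical_parameters ::
  "nat \<Rightarrow> int \<Rightarrow> real \<Rightarrow> real \<Rightarrow> (nat \<Rightarrow> nat) \<Rightarrow> (nat \<Rightarrow> nat) \<Rightarrow> bool" where
  "classical_parameters D b \<alpha> \<beta> bs cs \<longleftrightarrow> b \<noteq> 1 \<and>
     (\<forall>i<D. real (bs i) = (qint b D - qint b i) * (\<beta> - \<alpha> * qint b i)) \<and>
     (\<forall>i\<in>{1..D}. real (cs i) = qint b i * (1 + \<alpha> * qint b (i - 1)))"

definition adj_eigenvalue :: "'a set \<Rightarrow> ('a \<Rightarrow> 'a \<Rightarrow> bool) \<Rightarrow> real \<Rightarrow> bool" where
  "adj_eigenvalue V E \<theta> \<longleftrightarrow>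
     (\<exists>f :: 'a \<Rightarrow> real. (\<exists>x\<in>V. f x \<noteq> 0) \<and> (\<forall>x\<in>V. (\<Sum>y\<in>nbr V E x. f y) = \<theta> * f x))"

definition theta_min :: "'a set \<Rightarrow> ('a \<Rightarrow> 'a \<Rightarrow> bool) \<Rightarrow> real" where
  "theta_min V E = Min {\<theta>. adj_eigenvalue V E \<theta>}"

definition is_clique :: "'a set \<Rightarrow> ('a \<Rightarrow> 'a \<Rightarrow> bool) \<Rightarrow> 'a set \<Rightarrow> bool" where
  "is_clique V E C \<longleftrightarrow> C \<subseteq> V \<and> (\<forall>x\<in>C. \<forall>y\<in>C. x \<noteq> y \<longrightarrow> E x y)"

text \<open>Delsarte clique, k the valency.\<close>
definition delsarte_clique :: "'a set \<Rightarrow> ('a \<Rightarrow> 'a \<Rightarrow> bool) \<Rightarrow> nat \<Rightarrow> 'a set \<Rightarrow> bool" where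
  "delsarte_clique V E k C \<longleftrightarrow> is_clique V E C \<and>
     real (card C) = 1 + real k / (- theta_min V E)"

definition geometric :: "'a set \<Rightarrow> ('a \<Rightarrow> 'a \<Rightarrow> bool) \<Rightarrow> nat \<Rightarrow> bool" where
  "geometric V E k \<longleftrightarrow> (\<exists>\<C>. (\<forall>C\<in>\<C>. delsarte_clique V E k C) \<and>
     (\<forall>x y. adj V E x y \<longrightarrow> (\<exists>!C. C \<in> \<C> \<and> x \<in> C \<and> y \<in> C)))"

end

theory Submission
  imports Defs
begin

text \<open>Let \<open>\<mu> = c\<^sub>2 - 1\<close>; since \<open>D \<ge> 3\<close>, \<open>\<alpha> \<ge> 0\<close> and \<open>\<mu> \<ge> b\<close>, and the first bound gives
  \<open>b \<beta> \<ge> r \<mu> (b + 1)\<^sup>2\<close>. For an eigenvalue \<open>\<theta>\<close> with cosine sequence \<open>u\<close> the kernel \<open>u (d x y)\<close> is a multiple of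
  the projection onto the eigenspace of \<open>\<theta>\<close>, hence positive semidefinite. For the second largest
  eigenvalue this bounds the independent sets of a local graph by \<open>r (b + 1)\<close>. Counting the private
  neighbours of the members of a maximum independent set of size \<open>s\<close> yields a quadratic inequality for \<open>s\<close>
  with roots \<open>r (b + 1) / b\<close> and \<open>r (b + 1)\<close>, so \<open>s < r (b + 1) / b\<close>, and the private neighbourhoods are
  cliques of more than \<open>b \<beta> / (b + 1)\<close> vertices. It follows that every edge lies in a unique maximal
  clique (a line) that is this large. For \<open>\<theta> = - r\<close> the kernel shows that a line has at most \<open>\<beta> + 1\<close> vertices,
  and that every eigenfunction sums to zero on the lines attaining the bound. Comparing the trace of the
  projection over the points of the deficient lines with the number of these lines shows that there are
  too few such points, so all lines have \<open>\<beta> + 1\<close> vertices. Then \<open>A + r I\<close> is the Gram matrix of the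
  point-line incidence, hence \<open>- r\<close> is the smallest eigenvalue and the lines are Delsarte cliques.\<close>

section \<open>Eigenfunctions of distance-regular graphs\<close>

text \<open>This is the shape of a distance kernel on a clique, or on an independent set of a local
  graph: constant on the diagonal and constant off it.\<close>

lemma sum_pairs_two_valued:
  fixes h :: "'a \<Rightarrow> 'a \<Rightarrow> real"
  assumes "finite C" "\<And>x. x \<in> C \<Longrightarrow> h x x = p" "\<And>x y. x \<in> C \<Longrightarrow> y \<in> C \<Longrightarrow> x \<noteq> y \<Longrightarrow> h x y = s"
  shows "(\<Sum>x\<in>C. \<Sum>y\<in>C. h x y) = card C * (p + (real (card C) - 1) * s)"
proof -
  have "(\<Sum>y\<in>C. h x y) = p + (real (card C) - 1) * s" if "x \<in> C" for x
  proof -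
    have "(\<Sum>y\<in>C. h x y) = h x x + (\<Sum>y\<in>C - {x}. h x y)"
      using assms(1) that by (rule sum.remove)
    also have "(\<Sum>y\<in>C - {x}. h x y) = (\<Sum>y\<in>C - {x}. s)"
      using assms(3) that by (intro sum.cong) auto
    also have "card C \<ge> 1" using assms(1) that by (metis card_0_eq empty_iff less_one not_less)
    then have "(\<Sum>y\<in>C - {x}. s) = (real (card C) - 1) * s"
      using assms(1) that by (simp add: of_nat_diff)
    finally show ?thesis using assms(2) that by simp
  qed
  then show ?thesis by simp
qed

locale distance_regular_graph =
  fixes V :: "'a set" and E :: "'a \<Rightarrow> 'a \<Rightarrow> bool"
    and D :: nat and bs cs :: "nat \<Rightarrow> nat"
  assumes dr: "distance_regular V E D bs cs"
begin

abbreviation N :: "'a \<Rightarrow> 'a set" where "N \<equiv> nbr V E"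
abbreviation d :: "'a \<Rightarrow> 'a \<Rightarrow> nat" where "d \<equiv> gdist V E"

section \<open>Distances and intersection numbers\<close>

lemma finite_V [simp]: "finite V"
  and E_sym: "E x y \<Longrightarrow> E y x"
  and E_irrefl [simp]: "\<not> E x x"
  and V_nonempty: "V \<noteq> {}"
  using dr by (auto simp: distance_regular_def simple_graph_def)

lemma in_N: "y \<in> N x \<longleftrightarrow> y \<in> V \<and> E x y"
  by (auto simp: nbr_def)

lemma finite_N [simp]: "finite (N x)"
  by (auto simp: nbr_def)

lemma relpow_sym: "(x, y) \<in> edge_rel V E ^^ n \<Longrightarrow> (y, x) \<in> edge_rel V E ^^ n"
proof (induction n arbitrary: y)
  case (Suc n)
  then obtain z where z: "(x, z) \<in> edge_rel V E ^^ n" "(z, y) \<in> edge_rel V E" by auto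
  have "(y, z) \<in> edge_rel V E" using z(2) by (auto simp: edge_rel_def adj_def intro: E_sym)
  with Suc.IH[OF z(1)] show ?case by (metis relpow_Suc_I2)
qed auto

lemma relpow_ex: "x \<in> V \<Longrightarrow> y \<in> V \<Longrightarrow> \<exists>n. (x, y) \<in> edge_rel V E ^^ n"
  using dr by (auto simp: distance_regular_def connected_graph_def)

lemma relpow_d: "x \<in> V \<Longrightarrow> y \<in> V \<Longrightarrow> (x, y) \<in> edge_rel V E ^^ d x y"
  unfolding gdist_def using relpow_ex by (rule LeastI_ex)

lemma d_le: "(x, y) \<in> edge_rel V E ^^ n \<Longrightarrow> d x y \<le> n"
  unfolding gdist_def by (rule Least_le)

lemma d_sym: "d x y = d y x"
  unfolding gdist_def using relpow_sym by metis

lemma d_refl [simp]: "d x x = 0"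
  using d_le[of x x 0] by simp

lemma d_eq_0: "x \<in> V \<Longrightarrow> y \<in> V \<Longrightarrow> d x y = 0 \<longleftrightarrow> x = y"
  using relpow_d[of x y] by auto

lemma d_nbr_le: assumes "x \<in> V" "y \<in> V" "z \<in> N y" shows "d x z \<le> Suc (d x y)"
proof (rule d_le)
  have "(y, z) \<in> edge_rel V E" using assms by (auto simp: edge_rel_def adj_def in_N)
  with relpow_d[OF assms(1,2)] show "(x, z) \<in> edge_rel V E ^^ Suc (d x y)" by auto
qed

lemma N_sym: "x \<in> V \<Longrightarrow> y \<in> N x \<Longrightarrow> x \<in> N y"
  by (auto simp: in_N intro: E_sym)

lemma d_nbr_ge: assumes "x \<in> V" "y \<in> V" "z \<in> N y" shows "d x y \<le> Suc (d x z)"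
  using d_nbr_le[of x z y] assms N_sym by (auto simp: in_N)

lemma d_eq_1: assumes "x \<in> V" "y \<in> V" shows "d x y = 1 \<longleftrightarrow> E x y"
proof
  assume "d x y = 1"
  then have "(x, y) \<in> edge_rel V E ^^ 1" using relpow_d[OF assms] by metis
  then show "E x y" by (auto simp: edge_rel_def adj_def)
next
  assume "E x y"
  then have "y \<in> N x" "x \<noteq> y" using assms by (auto simp: in_N)
  then have "d x y \<le> 1" "d x y \<noteq> 0" using d_nbr_le[of x x y] assms d_eq_0 by auto
  then show "d x y = 1" by simp
qed

lemma finite_dists: "finite {d x y | x y. x \<in> V \<and> y \<in> V}"
proof -
  have "{d x y | x y. x \<in> V \<and> y \<in> V} = (\<lambda>(x, y). d x y) ` (V \<times> V)" by auto
  then show ?thesis by simp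
qed

lemma D_eq: "D = Max {d x y | x y. x \<in> V \<and> y \<in> V}"
  using dr by (auto simp: distance_regular_def diameter_def)

lemma d_le_D: "x \<in> V \<Longrightarrow> y \<in> V \<Longrightarrow> d x y \<le> D"
  unfolding D_eq using finite_dists by (intro Max_ge) auto

text \<open>Descend from the diameter: the last but one vertex of a shortest path lies exactly one
  step closer to its start.\<close>

lemma ex_dist: assumes "i \<le> D" shows "\<exists>x\<in>V. \<exists>y\<in>V. d x y = i"
  using assms
proof (induction rule: inc_induct)
  case base
  have "D \<in> {d x y | x y. x \<in> V \<and> y \<in> V}"
    unfolding D_eq using finite_dists V_nonempty by (intro Max_in) auto
  then show ?case by auto
next
  case (step n)
  then obtain x y where xy: "x \<in> V" "y \<in> V" "d x y = Suc n" by auto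
  with relpow_d[of x y] obtain z where z: "(x, z) \<in> edge_rel V E ^^ n" "(z, y) \<in> edge_rel V E" by auto
  then have zV: "z \<in> V" "y \<in> N z" by (auto simp: edge_rel_def adj_def in_N)
  have "d x z \<le> n" using z d_le by auto
  moreover have "Suc n \<le> Suc (d x z)" using d_nbr_le[of x z y] xy zV by auto
  ultimately show ?case using xy zV by (metis le_antisym Suc_le_mono)
qed

lemma card_up: "x \<in> V \<Longrightarrow> y \<in> V \<Longrightarrow> card {z \<in> N y. d x z = d x y + 1} = bs (d x y)"
  and card_down: "x \<in> V \<Longrightarrow> y \<in> V \<Longrightarrow> d x y \<ge> 1 \<Longrightarrow> card {z \<in> N y. d x z = d x y - 1} = cs (d x y)"
  using dr by (auto simp: distance_regular_def)

lemma card_N: assumes "x \<in> V" shows "card (N x) = bs 0"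
proof -
  have "{z \<in> N x. d x z = d x x + 1} = N x"
    using assms d_eq_1[of x] by (auto simp: in_N)
  then show ?thesis using card_up[OF assms assms] by simp
qed

lemma bs_D: "bs D = 0"
proof -
  obtain x y where xy: "x \<in> V" "y \<in> V" "d x y = D" using ex_dist[of D] by auto
  have "{z \<in> N y. d x z = d x y + 1} = {}" using d_le_D[of x] xy by (fastforce simp: in_N)
  then show ?thesis using card_up[OF xy(1,2)] xy(3) by (metis card.empty)
qed

lemma cs_pos: assumes "1 \<le> i" "i \<le> D" shows "cs i > 0"
proof -
  obtain x y where xy: "x \<in> V" "y \<in> V" "d x y = i" using ex_dist[OF assms(2)] by auto
  with relpow_d[of x y] assms obtain z where z: "(x, z) \<in> edge_rel V E ^^ (i - 1)" "(z, y) \<in> edge_rel V E" 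
    by (cases i) auto
  then have zV: "z \<in> V" "z \<in> N y" by (auto simp: edge_rel_def adj_def in_N intro: E_sym)
  have "d x z \<le> i - 1" using z d_le by auto
  moreover have "i \<le> Suc (d x z)" using d_nbr_ge[of x y z] xy zV by auto
  ultimately have "z \<in> {z \<in> N y. d x z = d x y - 1}" using xy zV by auto
  then have "card {z \<in> N y. d x z = d x y - 1} > 0" by (intro card_gt_0_iff[THEN iffD2]) auto
  moreover have "card {z \<in> N y. d x z = d x y - 1} = cs i"
    using card_down[OF xy(1,2)] xy(3) assms(1) by metis
  ultimately show ?thesis by metis
qed

text \<open>\<open>cs 0\<close> is unconstrained, so the intersection number \<open>c\<^sub>0 = 0\<close> is fixed here.\<close>

definition cc :: "nat \<Rightarrow> real" where "cc i = (if i = 0 then 0 else real (cs i))"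
definition as :: "nat \<Rightarrow> real" where "as i = real (bs 0) - real (bs i) - cc i"

text \<open>By the triangle inequality the neighbours of \<open>y\<close> lie at only three
  distances from \<open>x\<close>. For \<open>x = y\<close> the truncated \<open>d x y - 1\<close>
  does no harm, as \<open>cc 0 = 0\<close>.\<close>

lemma nbr_sum:
  fixes f :: "nat \<Rightarrow> real"
  assumes "x \<in> V" "y \<in> V"
  shows "(\<Sum>z\<in>N y. f (d x z)) = cc (d x y) * f (d x y - 1) + as (d x y) * f (d x y) + real (bs (d x y)) * f (d x y + 1)"
proof -
  let ?i = "d x y"
  define U where "U = {z \<in> N y. d x z = ?i + 1}"
  define L where "L = {z \<in> N y. d x z + 1 = ?i}"
  define M where "M = {z \<in> N y. d x z = ?i}"
  have fin: "finite U" "finite L" "finite M" by (auto simp: U_def L_def M_def)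
  have dis: "U \<inter> L = {}" "(U \<union> L) \<inter> M = {}" by (auto simp: U_def L_def M_def)
  have N: "N y = U \<union> L \<union> M"
    using d_nbr_le[of x y] d_nbr_ge[of x y] assms by (fastforce simp: U_def L_def M_def)
  have cU: "card U = bs ?i" using card_up[OF assms] by (simp add: U_def)
  have cL: "real (card L) = cc ?i"
  proof (cases "?i = 0")
    case True then show ?thesis by (simp add: L_def cc_def)
  next
    case False
    then have "L = {z \<in> N y. d x z = ?i - 1}" by (auto simp: L_def)
    then show ?thesis using card_down[OF assms] False by (simp add: cc_def)
  qed
  have "card (N y) = card U + card L + card M"
    unfolding N using fin dis by (simp add: card_Un_disjoint)
  then have cM: "real (card M) = as ?i" using card_N[OF assms(2)] cU cL by (simp add: as_def)
  have "(\<Sum>z\<in>N y. f (d x z)) = (\<Sum>z\<in>U. f (d x z)) + (\<Sum>z\<in>L. f (d x z)) + (\<Sum>z\<in>M. f (d x z))"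
    unfolding N using fin dis by (simp add: sum.union_disjoint)
  also have "(\<Sum>z\<in>U. f (d x z)) = (\<Sum>z\<in>U. f (?i + 1))" by (rule sum.cong) (auto simp: U_def)
  also have "(\<Sum>z\<in>L. f (d x z)) = (\<Sum>z\<in>L. f (?i - 1))" by (rule sum.cong) (auto simp: L_def intro!: arg_cong[where f=f])
  also have "(\<Sum>z\<in>M. f (d x z)) = (\<Sum>z\<in>M. f ?i)" by (rule sum.cong) (auto simp: M_def)
  finally show ?thesis using cU cL cM by simp
qed

lemma sum_N_swap:
  fixes f :: "'a \<Rightarrow> 'a \<Rightarrow> real"
  shows "(\<Sum>x\<in>V. \<Sum>y\<in>N x. f x y) = (\<Sum>y\<in>V. \<Sum>x\<in>N y. f x y)"
proof -
  have "(\<Sum>x\<in>V. \<Sum>y\<in>N x. f x y) = (\<Sum>x\<in>V. \<Sum>y\<in>V. if E x y then f x y else 0)"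
    by (simp add: nbr_def sum.inter_filter)
  also have "\<dots> = (\<Sum>y\<in>V. \<Sum>x\<in>V. if E x y then f x y else 0)" by (rule sum.swap)
  also have "\<dots> = (\<Sum>y\<in>V. \<Sum>x\<in>V. if E y x then f x y else 0)" by (intro sum.cong refl if_cong) (auto intro: E_sym)
  also have "\<dots> = (\<Sum>y\<in>V. \<Sum>x\<in>N y. f x y)" by (simp add: nbr_def sum.inter_filter)
  finally show ?thesis .
qed

section \<open>Cosine sequences and their positive semidefinite kernels\<close>

definition cosine_sequence :: "real \<Rightarrow> (nat \<Rightarrow> real) \<Rightarrow> bool" where
  "cosine_sequence \<theta> u \<longleftrightarrow> u 0 = 1 \<and>
     (\<forall>i\<le>D. cc i * u (i - 1) + as i * u i + real (bs i) * u (i + 1) = \<theta> * u i)"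

definition eigenfun :: "real \<Rightarrow> ('a \<Rightarrow> real) \<Rightarrow> bool" where
  "eigenfun \<theta> \<psi> \<longleftrightarrow> (\<forall>x\<in>V. (\<Sum>y\<in>N x. \<psi> y) = \<theta> * \<psi> x)"

lemma eigenfun_cosine:
  assumes "cosine_sequence \<theta> u" "x \<in> V"
  shows "eigenfun \<theta> (\<lambda>y. u (d x y))"
  unfolding eigenfun_def
proof
  fix y assume "y \<in> V"
  then show "(\<Sum>z\<in>N y. u (d x z)) = \<theta> * u (d x y)"
    using nbr_sum[of x y u] assms d_le_D[of x y] by (simp add: cosine_sequence_def)
qed

text \<open>For \<open>i \<le> D\<close>, \<open>K i\<close> is the number of vertices at distance
  \<open>i\<close> from a vertex, obtained by counting the edges between consecutive spheres from
  both sides.\<close>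

primrec K :: "nat \<Rightarrow> real" where
  "K 0 = 1"
| "K (Suc i) = K i * real (bs i) / real (cs (Suc i))"

text \<open>Adjacency is self-adjoint, so it can be moved from \<open>\<psi>\<close> to the
  indicator of the sphere of radius \<open>i\<close>, where \<open>nbr_sum\<close> evaluates
  it.\<close>

lemma sphere_sum_rec:
  assumes "eigenfun \<theta> \<psi>" "x \<in> V" "i \<le> D"
  shows "\<theta> * (\<Sum>y | y \<in> V \<and> d x y = i. \<psi> y) =
    cc (Suc i) * (\<Sum>y | y \<in> V \<and> d x y = Suc i. \<psi> y) + as i * (\<Sum>y | y \<in> V \<and> d x y = i. \<psi> y)
    + (if i = 0 then 0 else real (bs (i - 1)) * (\<Sum>y | y \<in> V \<and> d x y = i - 1. \<psi> y))"
proof -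
  define g where "g j = (if j = i then 1 else 0 :: real)" for j
  have g: "cc j * g (j - 1) + as j * g j + real (bs j) * g (j + 1) =
      (if j = Suc i then cc (Suc i) else 0) + (if j = i then as i else 0)
      + (if i \<noteq> 0 \<and> j = i - 1 then real (bs (i - 1)) else 0)" for j
    by (cases j; cases i) (simp_all add: g_def cc_def)
  have S: "(\<Sum>y | y \<in> V \<and> d x y = j. \<psi> y) = (\<Sum>y\<in>V. if d x y = j then \<psi> y else 0)" for j
    by (simp add: sum.inter_filter)
  have "\<theta> * (\<Sum>y | y \<in> V \<and> d x y = i. \<psi> y) = (\<Sum>y\<in>V. g (d x y) * (\<theta> * \<psi> y))"
    unfolding S sum_distrib_left by (rule sum.cong) (auto simp: g_def)
  also have "\<dots> = (\<Sum>y\<in>V. g (d x y) * (\<Sum>z\<in>N y. \<psi> z))"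
    using assms(1) by (simp add: eigenfun_def)
  also have "\<dots> = (\<Sum>y\<in>V. \<Sum>z\<in>N y. g (d x y) * \<psi> z)" by (simp add: sum_distrib_left)
  also have "\<dots> = (\<Sum>z\<in>V. \<Sum>y\<in>N z. g (d x y) * \<psi> z)" by (rule sum_N_swap)
  also have "\<dots> = (\<Sum>z\<in>V. \<psi> z * (\<Sum>y\<in>N z. g (d x y)))" by (simp add: sum_distrib_left mult.commute)
  also have "\<dots> = (\<Sum>z\<in>V. cc (Suc i) * (if d x z = Suc i then \<psi> z else 0)
      + as i * (if d x z = i then \<psi> z else 0)
      + (if i = 0 then 0 else real (bs (i - 1)) * (if d x z = i - 1 then \<psi> z else 0)))"
  proof (rule sum.cong[OF refl])
    fix z assume z: "z \<in> V"
    show "\<psi> z * (\<Sum>y\<in>N z. g (d x y)) = cc (Suc i) * (if d x z = Suc i then \<psi> z else 0)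
      + as i * (if d x z = i then \<psi> z else 0)
      + (if i = 0 then 0 else real (bs (i - 1)) * (if d x z = i - 1 then \<psi> z else 0))"
      unfolding nbr_sum[OF assms(2) z, of g] g by auto
  qed
  also have "\<dots> = cc (Suc i) * (\<Sum>y | y \<in> V \<and> d x y = Suc i. \<psi> y) + as i * (\<Sum>y | y \<in> V \<and> d x y = i. \<psi> y)
    + (if i = 0 then 0 else real (bs (i - 1)) * (\<Sum>y | y \<in> V \<and> d x y = i - 1. \<psi> y))"
    unfolding S by (simp add: sum.distrib sum_distrib_left)
  finally show ?thesis .
qed

text \<open>\<open>K i * u i\<close> satisfies the recursion of the sphere sums, and
  \<open>cs i > 0\<close> makes each sum determined by the two before it.\<close>

lemma sphere_sum:
  assumes "cosine_sequence \<theta> u" "eigenfun \<theta> \<psi>" "x \<in> V" "i \<le> D"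
  shows "(\<Sum>y | y \<in> V \<and> d x y = i. \<psi> y) = K i * u i * \<psi> x"
  using assms(4)
proof (induction i rule: less_induct)
  case (less i)
  let ?S = "\<lambda>i. (\<Sum>y | y \<in> V \<and> d x y = i. \<psi> y)"
  have u: "cc j * u (j - 1) + as j * u j + real (bs j) * u (j + 1) = \<theta> * u j" if "j \<le> D" for j
    using assms(1) that by (auto simp: cosine_sequence_def)
  show ?case
  proof (cases i)
    case 0
    have "{y. y \<in> V \<and> d x y = 0} = {x}" using d_eq_0 assms(3) by auto
    then show ?thesis using 0 assms(1) by (simp add: cosine_sequence_def)
  next
    case (Suc j)
    have Sj: "?S j = K j * u j * \<psi> x" using less Suc by auto
    have pos: "real (cs i) > 0" using cs_pos[of i] less Suc by auto
    have jD: "j \<le> D" using less Suc by auto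
    \<comment> \<open>For \<open>j > 0\<close> the definition of \<open>K\<close> gives
      \<open>K j * cc j = K (j - 1) * bs (j - 1)\<close>; both sides vanish for
      \<open>j = 0\<close>.\<close>
    have "(if j = 0 then 0 else real (bs (j - 1)) * ?S (j - 1)) = K j * cc j * u (j - 1) * \<psi> x"
    proof (cases j)
      case 0 then show ?thesis by (simp add: cc_def)
    next
      case (Suc l)
      have "real (cs j) > 0" using cs_pos[of j] Suc jD by auto
      moreover have "?S l = K l * u l * \<psi> x" using less Suc \<open>i = Suc j\<close> by auto
      ultimately show ?thesis using Suc by (simp add: cc_def)
    qed
    then have "\<theta> * (K j * u j * \<psi> x) = real (cs i) * ?S i + as j * (K j * u j * \<psi> x) + K j * cc j * u (j - 1) * \<psi> x"
      using sphere_sum_rec[OF assms(2,3) jD] Sj Suc by (simp add: cc_def)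
    moreover have "\<theta> * (K j * u j * \<psi> x) = K j * \<psi> x * (cc j * u (j - 1) + as j * u j + real (bs j) * u (j + 1))"
      unfolding u[OF jD] by simp
    ultimately have "real (cs i) * ?S i = K j * real (bs j) * u i * \<psi> x" using Suc by (simp add: algebra_simps)
    then show ?thesis using pos Suc by (simp add: field_simps)
  qed
qed

text \<open>Splitting the sum into spheres around \<open>x\<close> shows that the kernel acts on the
  eigenspace as a scalar.\<close>

lemma cosine_kernel_apply:
  assumes "cosine_sequence \<theta> u" "eigenfun \<theta> \<psi>" "x \<in> V"
  shows "(\<Sum>y\<in>V. u (d x y) * \<psi> y) = (\<Sum>i\<le>D. K i * (u i)\<^sup>2) * \<psi> x"
proof -
  have "(\<Sum>y\<in>V. u (d x y) * \<psi> y) = (\<Sum>i\<le>D. \<Sum>y | y \<in> V \<and> d x y = i. u (d x y) * \<psi> y)"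
    using sum.group[of V "{..D}" "d x" "\<lambda>y. u (d x y) * \<psi> y"] d_le_D assms(3) by (auto simp: image_subset_iff)
  also have "\<dots> = (\<Sum>i\<le>D. u i * (\<Sum>y | y \<in> V \<and> d x y = i. \<psi> y))"
    unfolding sum_distrib_left by (intro sum.cong) auto
  also have "\<dots> = (\<Sum>i\<le>D. K i * (u i)\<^sup>2 * \<psi> x)"
    using sphere_sum[OF assms] by (intro sum.cong) (auto simp: power2_eq_square)
  finally show ?thesis by (simp add: sum_distrib_right)
qed

text \<open>Applied to the eigenfunction \<open>u (d x y)\<close> of \<open>y\<close> at the point
  \<open>x\<close>, where its value is 1, the kernel yields a sum of squares with a summand
  1.\<close>

lemma cosine_kernel_norm_pos:
  assumes "cosine_sequence \<theta> u" shows "(\<Sum>i\<le>D. K i * (u i)\<^sup>2) > 0"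
proof -
  obtain x where x: "x \<in> V" using V_nonempty by auto
  have "(\<Sum>i\<le>D. K i * (u i)\<^sup>2) * u (d x x) = (\<Sum>y\<in>V. u (d x y) * u (d x y))"
    using cosine_kernel_apply[OF assms eigenfun_cosine[OF assms x] x] by simp
  also have "\<dots> \<ge> u (d x x) * u (d x x)"
    using x by (intro member_le_sum) auto
  finally show ?thesis using assms by (simp add: cosine_sequence_def)
qed

text \<open>The columns of the kernel are eigenfunctions, so the kernel divided by its scalar is a
  symmetric idempotent.\<close>

lemma cosine_kernel_square:
  assumes "cosine_sequence \<theta> u" "x \<in> V" "y \<in> V"
  shows "(\<Sum>z\<in>V. u (d x z) * u (d z y)) = (\<Sum>i\<le>D. K i * (u i)\<^sup>2) * u (d x y)"
  using cosine_kernel_apply[OF assms(1) eigenfun_cosine[OF assms(1,3)] assms(2)]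
  by (simp add: d_sym)

lemma cosine_kernel_psd:
  assumes "cosine_sequence \<theta> u"
  shows "(\<Sum>i\<le>D. K i * (u i)\<^sup>2) * (\<Sum>x\<in>V. \<Sum>y\<in>V. f x * f y * u (d x y))
    = (\<Sum>z\<in>V. (\<Sum>x\<in>V. u (d z x) * f x)\<^sup>2)"
proof -
  let ?C = "(\<Sum>i\<le>D. K i * (u i)\<^sup>2)"
  have "(\<Sum>z\<in>V. (\<Sum>x\<in>V. u (d z x) * f x)\<^sup>2) = (\<Sum>z\<in>V. \<Sum>x\<in>V. \<Sum>y\<in>V. (u (d z x) * f x) * (u (d z y) * f y))"
    by (simp add: power2_eq_square sum_product)
  also have "\<dots> = (\<Sum>x\<in>V. \<Sum>z\<in>V. \<Sum>y\<in>V. (u (d z x) * f x) * (u (d z y) * f y))" by (rule sum.swap)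
  also have "\<dots> = (\<Sum>x\<in>V. \<Sum>y\<in>V. \<Sum>z\<in>V. (u (d z x) * f x) * (u (d z y) * f y))"
    by (intro sum.cong refl sum.swap)
  also have "\<dots> = (\<Sum>x\<in>V. \<Sum>y\<in>V. f x * f y * (\<Sum>z\<in>V. u (d x z) * u (d z y)))"
    by (intro sum.cong refl) (simp add: sum_distrib_left d_sym mult_ac)
  also have "\<dots> = (\<Sum>x\<in>V. \<Sum>y\<in>V. ?C * (f x * f y * u (d x y)))"
    using cosine_kernel_square[OF assms] by (intro sum.cong refl) simp
  finally show ?thesis by (simp add: sum_distrib_left)
qed

lemma cosine_kernel_nonneg:
  assumes "cosine_sequence \<theta> u"
  shows "(\<Sum>x\<in>V. \<Sum>y\<in>V. f x * f y * u (d x y)) \<ge> 0"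
proof -
  have "(\<Sum>i\<le>D. K i * (u i)\<^sup>2) * (\<Sum>x\<in>V. \<Sum>y\<in>V. f x * f y * u (d x y)) \<ge> 0"
    unfolding cosine_kernel_psd[OF assms] by (intro sum_nonneg) auto
  then show ?thesis using cosine_kernel_norm_pos[OF assms] by (simp add: zero_le_mult_iff)
qed

lemma cosine_kernel_nonneg_on:
  assumes "cosine_sequence \<theta> u" "W \<subseteq> V"
  shows "(\<Sum>x\<in>W. \<Sum>y\<in>W. f x * f y * u (d x y)) \<ge> 0"
proof -
  define g where "g x = (if x \<in> W then f x else 0)" for x
  have "(\<Sum>x\<in>V. \<Sum>y\<in>V. g x * g y * u (d x y)) = (\<Sum>x\<in>W. \<Sum>y\<in>V. g x * g y * u (d x y))"
    using assms(2) by (intro sum.mono_neutral_right) (auto simp: g_def)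
  also have "\<dots> = (\<Sum>x\<in>W. \<Sum>y\<in>W. g x * g y * u (d x y))"
    using assms(2) by (intro sum.cong refl sum.mono_neutral_right) (auto simp: g_def)
  also have "\<dots> = (\<Sum>x\<in>W. \<Sum>y\<in>W. f x * f y * u (d x y))"
    by (intro sum.cong refl) (auto simp: g_def)
  finally show ?thesis using cosine_kernel_nonneg[OF assms(1), of g] by simp
qed

lemma clique_kernel_sum:
  assumes "u 0 = 1" "is_clique V E C"
  shows "(\<Sum>x\<in>C. \<Sum>y\<in>C. u (d x y)) = card C * (1 + (real (card C) - 1) * u 1)"
proof (rule sum_pairs_two_valued)
  show "finite C" using assms(2) by (auto simp: is_clique_def intro: finite_subset)
  fix x y assume "x \<in> C" "y \<in> C" "x \<noteq> y"
  then have "d x y = 1" using assms(2) by (subst d_eq_1) (auto simp: is_clique_def)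
  then show "u (d x y) = u 1" by simp
qed (use assms in auto)

end

section \<open>Classical parameters\<close>

lemma qint_0 [simp]: "qint b 0 = 0"
  by (simp add: qint_def)

lemma qint_Suc: "b \<noteq> 1 \<Longrightarrow> qint b (Suc i) = real_of_int b * qint b i + 1"
  by (simp add: qint_def field_simps)

lemma qint_nonneg: "b \<ge> 2 \<Longrightarrow> qint b i \<ge> 0"
  by (induction i) (auto simp: qint_Suc)

lemma qint_mono: assumes "b \<ge> 2" "i \<le> j" shows "qint b i \<le> qint b j"
  using assms(2)
proof (induction rule: dec_induct)
  case (step n)
  have "1 * qint b n \<le> real_of_int b * qint b n"
    using assms(1) qint_nonneg by (intro mult_right_mono) auto
  then show ?case using step assms(1) by (simp add: qint_Suc)
qed auto

locale classical_graph = distance_regular_graph V E D bs cs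
  for V :: "'a set" and E :: "'a \<Rightarrow> 'a \<Rightarrow> bool" and D :: nat and bs cs :: "nat \<Rightarrow> nat" +
  fixes b :: int and \<alpha> \<beta> :: real
  assumes cp: "classical_parameters D b \<alpha> \<beta> bs cs"
    and b_ge: "b \<ge> 2" and D_ge: "D \<ge> 3"
begin

abbreviation q :: real where "q \<equiv> real_of_int b"
abbreviation r :: real where "r \<equiv> qint b D"
abbreviation Q :: "nat \<Rightarrow> real" where "Q \<equiv> qint b"
definition \<mu> :: real where "\<mu> = \<alpha> * q + q + \<alpha>"

lemma q_ge: "q \<ge> 2" using b_ge by simp

lemma Q_Suc: "Q (Suc i) = q * Q i + 1" using qint_Suc b_ge by simp
lemma Q_nonneg: "Q i \<ge> 0" using qint_nonneg b_ge by simp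
lemma Q_mono: "i \<le> j \<Longrightarrow> Q i \<le> Q j" using qint_mono b_ge by simp
lemma Q_1 [simp]: "Q (Suc 0) = 1" by (simp add: Q_Suc)

lemma bs_eq: "i \<le> D \<Longrightarrow> real (bs i) = (r - Q i) * (\<beta> - \<alpha> * Q i)"
  using cp bs_D by (cases "i = D") (auto simp: classical_parameters_def)
lemma cs_eq: "1 \<le> i \<Longrightarrow> i \<le> D \<Longrightarrow> real (cs i) = Q i * (1 + \<alpha> * Q (i - 1))"
  using cp by (auto simp: classical_parameters_def)

lemma r_ge: "r \<ge> q\<^sup>2 + q + 1"
proof -
  have "Q 3 = q\<^sup>2 + q + 1" by (simp add: eval_nat_numeral Q_Suc algebra_simps)
  then show ?thesis using Q_mono[OF D_ge] by simp
qed

lemma r_ge_q: "r \<ge> q + 1" "r \<ge> 7"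
proof -
  have "q\<^sup>2 \<ge> 2 * q" using q_ge by (simp add: power2_eq_square)
  then show "r \<ge> q + 1" "r \<ge> 7" using r_ge q_ge by linarith+
qed

lemma cs_2: "real (cs 2) = (q + 1) * (1 + \<alpha>)"
  using cs_eq[of 2] D_ge by (simp add: eval_nat_numeral Q_Suc)

text \<open>Positivity of \<open>cs 3\<close> gives \<open>1 + \<alpha> * (q + 1) > 0\<close>. Since
  \<open>(q + 1) * (1 + \<alpha>)\<close> exceeds \<open>q\<close> by this amount, the integer
  \<open>cs 2\<close> is at least \<open>q + 1\<close>.\<close>

lemma alpha_nonneg: "\<alpha> \<ge> 0"
proof -
  have "Q 3 * (1 + \<alpha> * (q + 1)) > 0"
    using cs_pos[of 3] cs_eq[of 3] D_ge by (simp add: eval_nat_numeral Q_Suc)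
  then have "1 + \<alpha> * (q + 1) > 0" using Q_nonneg[of 3] by (simp add: zero_less_mult_iff)
  then have "real (cs 2) > q" unfolding cs_2 by (simp add: algebra_simps)
  then have "int (cs 2) > b" by linarith
  then have "int (cs 2) \<ge> b + 1" by linarith
  then have "real (cs 2) \<ge> q + 1" by linarith
  then have "(q + 1) * \<alpha> \<ge> 0" unfolding cs_2 by (simp add: algebra_simps)
  then show ?thesis using q_ge by (simp add: zero_le_mult_iff)
qed

lemma cs_2_mu: "real (cs 2) = \<mu> + 1"
  by (simp add: cs_2 \<mu>_def algebra_simps)

lemma mu_ge: "\<mu> \<ge> q" "\<mu> \<ge> \<alpha> * (q + 1) + 2" "\<mu> \<ge> 3 * \<alpha> + 2"
proof -
  have "\<alpha> * q \<ge> \<alpha> * 2" using alpha_nonneg q_ge by (rule mult_left_mono[rotated])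
  then show "\<mu> \<ge> q" "\<mu> \<ge> \<alpha> * (q + 1) + 2" "\<mu> \<ge> 3 * \<alpha> + 2"
    using alpha_nonneg q_ge by (auto simp: \<mu>_def algebra_simps)
qed

end

section \<open>Consequences of the lower bound on \<beta>\<close>

locale large_classical_graph = classical_graph +
  assumes beta_bound: "q * \<beta> \<ge> r * \<mu> * (q + 1)\<^sup>2"
begin

lemma beta_ge: "\<beta> \<ge> 9/2 * (r * \<mu>)"
proof -
  have rm: "r * \<mu> \<ge> 0" using r_ge_q mu_ge q_ge by (intro mult_nonneg_nonneg) auto
  \<comment> \<open>The quotient \<open>(q + 1)\<^sup>2 / q\<close> is smallest at
    \<open>q = 2\<close>, where it equals 9/2.\<close>
  have "(q - 2) * (q - 1/2) \<ge> 0" using q_ge by simp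
  then have "9/2 * q \<le> (q + 1)\<^sup>2" by (simp add: power2_eq_square algebra_simps)
  then have "9/2 * q * (r * \<mu>) \<le> (q + 1)\<^sup>2 * (r * \<mu>)" using rm by (rule mult_right_mono)
  also have "\<dots> \<le> q * \<beta>" using beta_bound by (simp add: mult_ac)
  finally have "q * (9/2 * (r * \<mu>)) \<le> q * \<beta>" by (simp add: mult_ac)
  then show ?thesis using q_ge by (subst (asm) mult_le_cancel_left_pos) auto
qed

lemma beta_ge_r: "\<beta> \<ge> 9/2 * r * (3 * \<alpha> + 2)" "\<beta> \<ge> 9 * r" "\<beta> > 0"
proof -
  have "r * (3 * \<alpha> + 2) \<le> r * \<mu>" using mu_ge r_ge_q by (intro mult_left_mono) auto
  then show *: "\<beta> \<ge> 9/2 * r * (3 * \<alpha> + 2)" using beta_ge by simp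
  have "r * \<alpha> \<ge> 0" using alpha_nonneg r_ge_q by simp
  with * show "\<beta> \<ge> 9 * r" by (simp add: algebra_simps)
  then show "\<beta> > 0" using r_ge_q by simp
qed

lemma beta_minus_pos: "i \<le> D \<Longrightarrow> \<beta> - \<alpha> * Q i \<ge> \<beta> - \<alpha> * r" "\<beta> - \<alpha> * r > 0"
proof -
  show "i \<le> D \<Longrightarrow> \<beta> - \<alpha> * Q i \<ge> \<beta> - \<alpha> * r"
    using Q_mono alpha_nonneg by (simp add: mult_left_mono)
  have "r * \<alpha> \<ge> 0" using alpha_nonneg r_ge_q by simp
  then show "\<beta> - \<alpha> * r > 0" using beta_ge_r(1) r_ge_q by (simp add: algebra_simps)
qed

lemma bs_0: "real (bs 0) = r * \<beta>"
  using bs_eq[of 0] by simp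

lemma cs_1: "cs 1 = 1"
  using cs_eq[of 1] D_ge by simp

lemma as_eq: "i \<le> D \<Longrightarrow> as i = Q i * (\<beta> - 1 + \<alpha> * (r - Q i - (if i = 0 then 0 else Q (i - 1))))"
  by (auto simp: as_def bs_eq cc_def cs_eq algebra_simps)

lemma as_1: "as 1 = \<beta> - 1 + \<alpha> * (r - 1)"
  using as_eq[of 1] D_ge by simp

section \<open>Two explicit cosine sequences and the bounds they give\<close>

primrec u :: "nat \<Rightarrow> real" where
  "u 0 = 1"
| "u (Suc i) = - u i * (1 + \<alpha> * Q i) / (\<beta> - \<alpha> * Q i)"

lemma u_1: "u 1 = - 1 / \<beta>"
  by simp

text \<open>The two-term recurrence suffices: applied upwards and downwards it turns both the
  \<open>bs i\<close> term and the \<open>cc i\<close> term into multiples of \<open>u i\<close>,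
  and these add up with \<open>as i\<close> to \<open>- r\<close>.\<close>

lemma cosine_u: "cosine_sequence (- r) u"
  unfolding cosine_sequence_def
proof (intro conjI allI impI)
  fix i assume i: "i \<le> D"
  have pos: "\<beta> - \<alpha> * Q j > 0" if "j \<le> D" for j
    using beta_minus_pos(1)[of j] beta_minus_pos(2) that by linarith
  have up: "real (bs i) * u (i + 1) = - ((r - Q i) * (1 + \<alpha> * Q i) * u i)"
    using pos[OF i] bs_eq[OF i] by (simp add: mult_ac)
  show "cc i * u (i - 1) + as i * u i + real (bs i) * u (i + 1) = - r * u i"
  proof (cases i)
    case 0 then show ?thesis using up by (simp add: cc_def as_def)
  next
    case (Suc j)
    have "u i * (\<beta> - \<alpha> * Q j) = - (u j * (1 + \<alpha> * Q j))"
      using pos[of j] i Suc by simp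
    then have "u j * (1 + \<alpha> * Q j) = - (u i * (\<beta> - \<alpha> * Q j))" by linarith
    moreover have "cc i * u j = Q i * (u j * (1 + \<alpha> * Q j))"
      using cs_eq[of i] i Suc by (simp add: cc_def mult_ac)
    ultimately have dn: "cc i * u j = - (Q i * (u i * (\<beta> - \<alpha> * Q j)))" by (simp only: mult_minus_right)
    have j: "i - 1 = j" "(i = 0) = False" using Suc by auto
    show ?thesis unfolding up as_eq[OF i] j dn if_False by (simp add: algebra_simps)
  qed
qed simp

text \<open>The cosine sequence of the eigenvalue \<open>b\<^sub>1 / b - 1\<close> is affine in \<open>b ^ (- i)\<close>; the recurrence forces \<open>\<tau>\<close>.\<close>

definition \<tau> :: real where "\<tau> = 1 + (\<beta> + \<alpha> * (r - 1) + q) / ((q - 1) * (r * \<beta>))"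
definition w :: "nat \<Rightarrow> real" where "w i = 1 - \<tau> + \<tau> / q ^ i"

lemma tau_pos: "\<tau> > 0" "r * \<beta> * (1 - \<tau>) * (q - 1) = - (\<beta> + \<alpha> * (r - 1) + q)"
proof -
  have "\<alpha> * (r - 1) \<ge> 0" using alpha_nonneg r_ge_q by simp
  then show "\<tau> > 0" unfolding \<tau>_def using beta_ge_r r_ge_q q_ge by (intro add_pos_nonneg divide_nonneg_pos) auto
  show "r * \<beta> * (1 - \<tau>) * (q - 1) = - (\<beta> + \<alpha> * (r - 1) + q)"
    unfolding \<tau>_def using beta_ge_r r_ge_q q_ge by simp
qed

text \<open>The eigenvalue is read off from the equation at \<open>i = 0\<close>, where the left
  side is the valency times \<open>w 1\<close>.\<close>

lemma cosine_w: "cosine_sequence (r * \<beta> * w 1) w"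
  unfolding cosine_sequence_def
proof (intro conjI allI impI)
  fix i assume i: "i \<le> D"
  define t where "t = 1 / q ^ i"
  have t: "t * (1 + (q - 1) * Q i) = 1" using q_ge by (simp add: t_def qint_def)
  have wi: "w i = 1 - \<tau> + \<tau> * t" by (simp add: w_def t_def)
  have wS: "q * w (i + 1) = q * (1 - \<tau>) + \<tau> * t" using q_ge by (simp add: w_def t_def field_simps)
  have dn: "cc i * w (i - 1) = cc i * (1 - \<tau> + \<tau> * t * q)"
    using q_ge by (cases i) (simp_all add: cc_def w_def t_def)
  \<comment> \<open>The quadratic terms \<open>\<alpha> * (Q i)\<^sup>2\<close> cancel, leaving an
    expression affine in \<open>Q i\<close>; its slope is what \<tau> is fitted to.\<close>
  have e: "real (bs i) - q * cc i = r * \<beta> + r * \<beta> * (1 - \<tau>) * (q - 1) * Q i"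
  proof (cases i)
    case 0 then show ?thesis using bs_0 by (simp add: cc_def)
  next
    case (Suc j)
    have "cc i = Q i * (1 + \<alpha> * Q j)" using cs_eq[of i] Suc i by (simp add: cc_def)
    moreover have "Q i = q * Q j + 1" using Suc Q_Suc by simp
    ultimately have "q * cc i = Q i * (q + \<alpha> * (Q i - 1))" by (simp add: algebra_simps)
    then show ?thesis unfolding tau_pos bs_eq[OF i] by (simp add: algebra_simps)
  qed
  have "q * (cc i * w (i - 1) + as i * w i + real (bs i) * w (i + 1) - r * \<beta> * w 1 * w i)
    = q * (cc i * w (i - 1) + as i * w i - r * \<beta> * w 1 * w i) + real (bs i) * (q * w (i + 1))"
    by (simp add: algebra_simps)
  also have "\<dots> = q * (r * \<beta>) * (1 - w 1) * w i + \<tau> * t * (q - 1) * (q * cc i - real (bs i))"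
    unfolding dn wi wS as_def bs_0 by (simp add: algebra_simps)
  also have "\<dots> = r * \<beta> * \<tau> * (q - 1) * w i - \<tau> * t * (q - 1) * (r * \<beta> + r * \<beta> * (1 - \<tau>) * (q - 1) * Q i)"
  proof -
    have "q * (1 - w 1) = \<tau> * (q - 1)" using q_ge by (simp add: w_def field_simps)
    then have "(r * \<beta>) * w i * (q * (1 - w 1)) = (r * \<beta>) * w i * (\<tau> * (q - 1))" by (simp only:)
    then have f1: "q * (r * \<beta>) * (1 - w 1) * w i = r * \<beta> * \<tau> * (q - 1) * w i" by (simp only: mult_ac)
    have f2: "q * cc i - real (bs i) = - (r * \<beta> + r * \<beta> * (1 - \<tau>) * (q - 1) * Q i)" using e by simp
    show ?thesis by (simp only: f1 f2 mult_minus_right add_uminus_conv_diff)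
  qed
  also have "\<dots> = r * \<beta> * \<tau> * (q - 1) * ((1 - \<tau>) + \<tau> * t - t - (1 - \<tau>) * (t * ((q - 1) * Q i)))"
    unfolding wi by (simp add: algebra_simps)
  also have "t * ((q - 1) * Q i) = 1 - t" using t by (simp add: algebra_simps)
  also have "(1 - \<tau>) + \<tau> * t - t - (1 - \<tau>) * (1 - t) = 0" by (simp add: algebra_simps)
  finally show "cc i * w (i - 1) + as i * w i + real (bs i) * w (i + 1) = r * \<beta> * w 1 * w i"
    using q_ge by simp
qed (simp add: w_def)

text \<open>The summands start at 1 and at least halve at each step, because \<beta> is large
  compared with \<open>r * (1 + \<alpha>)\<close>. Hence the diagonal of the projection onto the
  eigenspace of \<open>- r\<close> is at least 1/2.\<close>

lemma kernel_norm_le: "(\<Sum>i\<le>D. K i * (u i)\<^sup>2) \<le> 2"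
proof -
  have K: "K i \<ge> 0" for i by (induction i) auto
  have simplify_ratio: "x * B / (S * A) * (A / B)\<^sup>2 = x * A / (S * B)"
    if "B > 0" "A > 0" "S > 0" for x A B S :: real
    using that by (simp add: field_simps power2_eq_square)
  have step: "K (Suc i) * (u (Suc i))\<^sup>2 \<le> K i * (u i)\<^sup>2 / 2" if i: "i < D" for i
  proof -
    have p1: "\<beta> - \<alpha> * Q i > 0" using beta_minus_pos(1)[of i] beta_minus_pos(2) i by linarith
    have p2: "1 + \<alpha> * Q i > 0" using alpha_nonneg Q_nonneg[of i] by (simp add: add_pos_nonneg)
    have p3: "Q (Suc i) > 0" using Q_nonneg[of i] q_ge by (simp add: Q_Suc add_nonneg_pos)
    have "K (Suc i) * (u (Suc i))\<^sup>2 =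
      K i * (u i)\<^sup>2 * ((r - Q i) * (\<beta> - \<alpha> * Q i) / (Q (Suc i) * (1 + \<alpha> * Q i)) * ((1 + \<alpha> * Q i) / (\<beta> - \<alpha> * Q i))\<^sup>2)"
      using bs_eq[of i] cs_eq[of "Suc i"] i by (simp add: power_mult_distrib power_divide)
    also have "(r - Q i) * (\<beta> - \<alpha> * Q i) / (Q (Suc i) * (1 + \<alpha> * Q i)) * ((1 + \<alpha> * Q i) / (\<beta> - \<alpha> * Q i))\<^sup>2
       = (r - Q i) * (1 + \<alpha> * Q i) / (Q (Suc i) * (\<beta> - \<alpha> * Q i))"
      using simplify_ratio p1 p2 p3 by blast
    also have "\<dots> \<le> 1/2"
    proof -
      have Qle: "Q i \<le> Q (Suc i)" "1 \<le> Q (Suc i)" using Q_mono[of i "Suc i"] Q_nonneg[of i] q_ge by (auto simp: Q_Suc)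
      have "1 + \<alpha> * Q i \<le> Q (Suc i) + \<alpha> * Q (Suc i)"
        using Qle alpha_nonneg by (intro add_mono mult_left_mono) auto
      then have "(r - Q i) * (1 + \<alpha> * Q i) \<le> r * (Q (Suc i) + \<alpha> * Q (Suc i))"
        using Q_nonneg[of i] r_ge_q p2 by (intro mult_mono) auto
      also have "\<dots> = Q (Suc i) * (r * (1 + \<alpha>))" by (simp add: algebra_simps)
      also have "\<dots> \<le> Q (Suc i) * ((\<beta> - \<alpha> * Q i) / 2)"
      proof (rule mult_left_mono)
        have "r * \<alpha> \<ge> 0" using alpha_nonneg r_ge_q by simp
        then show "r * (1 + \<alpha>) \<le> (\<beta> - \<alpha> * Q i) / 2"
          using beta_minus_pos(1)[of i] i beta_ge_r(1) r_ge_q by (simp add: algebra_simps)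
      qed (use p3 in auto)
      finally show ?thesis using p1 p3 by (simp add: pos_divide_le_eq)
    qed
    then have "K i * (u i)\<^sup>2 * ((r - Q i) * (1 + \<alpha> * Q i) / (Q (Suc i) * (\<beta> - \<alpha> * Q i))) \<le> K i * (u i)\<^sup>2 * (1/2)"
      using K[of i] by (intro mult_left_mono) auto
    finally show ?thesis by simp
  qed
  have le: "K i * (u i)\<^sup>2 \<le> (1/2) ^ i" if "i \<le> D" for i
    using that
  proof (induction i)
    case (Suc i) then show ?case using step[of i] by simp
  qed simp
  have "(\<Sum>i\<le>D. K i * (u i)\<^sup>2) \<le> (\<Sum>i\<le>D. (1/2) ^ i)" using le by (intro sum_mono) auto
  also have "\<dots> = 2 - (1/2) ^ D" by (induction D) auto
  also have "\<dots> \<le> 2" by simp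
  finally show ?thesis .
qed

text \<open>The kernel of \<open>- r\<close> is nonnegative on the indicator of \<open>C\<close>,
  where \<open>u 1 = - 1 / \<beta>\<close>.\<close>

lemma clique_card_le:
  assumes "is_clique V E C" shows "real (card C) \<le> \<beta> + 1"
proof (cases "card C = 0")
  case False
  have "(\<Sum>x\<in>C. \<Sum>y\<in>C. 1 * 1 * u (d x y)) \<ge> 0"
    using assms by (intro cosine_kernel_nonneg_on[OF cosine_u]) (auto simp: is_clique_def)
  then have "real (card C) * (1 + (real (card C) - 1) * u 1) \<ge> 0"
    using clique_kernel_sum[OF _ assms, of u] by simp
  then have "1 + (real (card C) - 1) * u 1 \<ge> 0" using False by (simp add: zero_le_mult_iff)
  then show ?thesis unfolding u_1 using beta_ge_r by (simp add: field_simps)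
qed (use beta_ge_r in auto)

text \<open>For this size the quadratic form vanishes on the indicator of \<open>C\<close>. By
  \<open>cosine_kernel_psd\<close> the kernel then annihilates the indicator.\<close>

lemma delsarte_clique_kernel:
  assumes "is_clique V E C" "real (card C) = \<beta> + 1" "z \<in> V"
  shows "(\<Sum>x\<in>C. u (d z x)) = 0"
proof -
  have CV: "C \<subseteq> V" using assms by (auto simp: is_clique_def)
  define f where "f x = (if x \<in> C then 1 else 0 :: real)" for x
  have f: "(\<Sum>x\<in>V. u (d z x) * f x) = (\<Sum>x\<in>C. u (d z x))" for z
    using CV by (intro sum.mono_neutral_cong_right) (auto simp: f_def)
  have "(\<Sum>x\<in>V. \<Sum>y\<in>V. f x * f y * u (d x y)) = (\<Sum>x\<in>V. f x * (\<Sum>y\<in>V. u (d x y) * f y))"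
    by (simp add: sum_distrib_left mult_ac)
  also have "\<dots> = (\<Sum>x\<in>C. \<Sum>y\<in>C. u (d x y))"
    unfolding f using CV by (intro sum.mono_neutral_cong_right) (auto simp: f_def)
  also have "\<dots> = 0"
    using clique_kernel_sum[OF _ assms(1), of u] u_1 assms(2) beta_ge_r by simp
  finally have "(\<Sum>z\<in>V. (\<Sum>x\<in>C. u (d z x))\<^sup>2) = 0"
    using cosine_kernel_psd[OF cosine_u, of f] f by simp
  then show ?thesis using assms(3) by (subst (asm) sum_nonneg_eq_0_iff) auto
qed

lemma independent_card_le:
  assumes "x \<in> V" "I \<subseteq> N x" "\<And>y z. y \<in> I \<Longrightarrow> z \<in> I \<Longrightarrow> \<not> E y z"
  shows "real (card I) \<le> r * (q + 1)"
proof (cases "card I = 0")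
  case False
  let ?s = "real (card I)"
  have fin: "finite I" using assms(2) finite_N finite_subset by blast
  have IV: "I \<subseteq> V" "x \<notin> I" using assms by (auto simp: in_N)
  \<comment> \<open>With weight 1 on \<open>I\<close>, this weight at \<open>x\<close> minimises the
    quadratic form.\<close>
  define f where "f y = (if y = x then - w 1 * ?s else 1)" for y
  have dx: "d x y = 1" "d y x = 1" if "y \<in> I" for y
    using that assms d_eq_1[of x y] d_sym[of x y] by (auto simp: in_N)
  have d2: "d y z = 2" if "y \<in> I" "z \<in> I" "y \<noteq> z" for y z
  proof -
    have "d y z \<le> 2" using d_nbr_le[of y x z] dx(2)[OF that(1)] that assms IV by fastforce
    moreover have "d y z \<noteq> 0" "d y z \<noteq> 1" using d_eq_0[of y z] d_eq_1[of y z] that IV assms(3) by auto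
    ultimately show ?thesis by linarith
  qed
  have "(\<Sum>y\<in>insert x I. \<Sum>z\<in>insert x I. f y * f z * w (d y z)) \<ge> 0"
    using assms IV by (intro cosine_kernel_nonneg_on[OF cosine_w]) auto
  also have "(\<Sum>y\<in>insert x I. \<Sum>z\<in>insert x I. f y * f z * w (d y z))
    = f x * f x * w 0 + (\<Sum>z\<in>I. f x * f z * w (d x z)) + (\<Sum>y\<in>I. f y * f x * w (d y x)) + (\<Sum>y\<in>I. \<Sum>z\<in>I. f y * f z * w (d y z))"
    using fin IV by (simp add: sum.distrib)
  also have "(\<Sum>z\<in>I. f x * f z * w (d x z)) = (\<Sum>z\<in>I. - w 1 * ?s * w 1)"
    using dx IV by (intro sum.cong) (auto simp: f_def)
  also have "(\<Sum>y\<in>I. f y * f x * w (d y x)) = (\<Sum>z\<in>I. - w 1 * ?s * w 1)"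
    using dx IV by (intro sum.cong) (auto simp: f_def)
  also have "(\<Sum>y\<in>I. \<Sum>z\<in>I. f y * f z * w (d y z)) = ?s * (1 + (?s - 1) * w 2)"
    using fin IV d2 by (intro sum_pairs_two_valued) (auto simp: f_def w_def)
  finally have "0 \<le> ?s * (1 - w 2 - ?s * ((w 1)\<^sup>2 - w 2))"
    by (simp add: f_def w_def[of 0] power2_eq_square algebra_simps)
  then have A: "?s * ((w 1)\<^sup>2 - w 2) \<le> 1 - w 2" using False by (simp add: zero_le_mult_iff)
  \<comment> \<open>As \<open>w\<close> is affine in the powers of \<open>1 / q\<close>, quotients
    of its differences do not involve \<tau>.\<close>
  have B: "1 - w 2 = (q + 1) * (w 1 - w 2)"
    using q_ge by (simp add: w_def field_simps power2_eq_square)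
  have C: "w 1 - w 2 > 0"
  proof -
    have "w 1 - w 2 = \<tau> * (q - 1) / q\<^sup>2" using q_ge by (simp add: w_def field_simps power2_eq_square)
    then show ?thesis using tau_pos q_ge by simp
  qed
  \<comment> \<open>The cosine recurrence at \<open>i = 1\<close>, with \<open>cs 1 = 1\<close>,
    converts the bound \<open>A\<close> into one in terms of \<open>as 1\<close>.\<close>
  have "1 + as 1 * w 1 + (r * \<beta> - as 1 - 1) * w 2 = r * \<beta> * (w 1)\<^sup>2"
    using cosine_w D_ge cs_1 unfolding cosine_sequence_def
    by (auto simp: cc_def as_def bs_0 power2_eq_square w_def[of 0] dest!: spec[of _ 1] simp flip: One_nat_def simp: one_add_one)
  then have F: "r * \<beta> * ((w 1)\<^sup>2 - w 2) = (w 1 - w 2) * (as 1 + 1 + q)"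
    using B by (simp add: algebra_simps)
  have rb: "r * \<beta> > 0" using r_ge_q beta_ge_r by simp
  have "(w 1 - w 2) * (?s * (as 1 + 1 + q)) = ?s * (r * \<beta> * ((w 1)\<^sup>2 - w 2))"
    unfolding F by (simp only: mult_ac)
  also have "\<dots> = (r * \<beta>) * (?s * ((w 1)\<^sup>2 - w 2))" by (simp only: mult_ac)
  also have "\<dots> \<le> (r * \<beta>) * (1 - w 2)"
    using A rb by (intro mult_left_mono) auto
  also have "\<dots> = (w 1 - w 2) * (r * \<beta> * (q + 1))"
    unfolding B by (simp only: mult_ac)
  finally have "(w 1 - w 2) * (?s * (as 1 + 1 + q)) \<le> (w 1 - w 2) * (r * \<beta> * (q + 1))" .
  then have G: "?s * (as 1 + 1 + q) \<le> r * \<beta> * (q + 1)" using C by simp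
  have "\<alpha> * (r - 1) \<ge> 0" using alpha_nonneg r_ge_q by simp
  then have "as 1 + 1 + q \<ge> \<beta>" using as_1 q_ge by simp
  then have "?s * \<beta> \<le> ?s * (as 1 + 1 + q)" by (intro mult_left_mono) auto
  with G have "\<beta> * ?s \<le> \<beta> * (r * (q + 1))" by (simp add: mult_ac)
  then show ?thesis using beta_ge_r by simp
qed (use r_ge_q q_ge in auto)

end

section \<open>Lines\<close>

context large_classical_graph
begin

section \<open>Common neighbours in local graphs\<close>

lemma card_common_nbrs_edge:
  assumes "x \<in> V" "y \<in> N x" shows "real (card {z \<in> N x. E y z}) = as 1"
proof -
  have y: "y \<in> V" "d x y = 1" using assms d_eq_1[of x y] by (auto simp: in_N)
  have "{z \<in> N x. E y z} = {z \<in> N y. d x z = 1}" using assms d_eq_1[of x] by (auto simp: in_N)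
  then have "real (card {z \<in> N x. E y z}) = (\<Sum>z\<in>N y. if d x z = 1 then 1 else 0)"
    by (simp add: sum.inter_filter[symmetric])
  then show ?thesis using nbr_sum[OF assms(1) y(1), of "\<lambda>i. if i = 1 then 1 else 0"] y by simp
qed

lemma card_common_nbrs:
  assumes "x \<in> V" "y \<in> N x" "z \<in> N x" "y \<noteq> z" "\<not> E y z"
  shows "card {w \<in> V. E y w \<and> E z w} = cs 2"
proof -
  have V: "y \<in> V" "z \<in> V" using assms by (auto simp: in_N)
  have "d y z \<le> Suc (d y x)" using assms V by (intro d_nbr_le) auto
  moreover have "d y x = 1" using assms d_eq_1[of y x] V by (auto simp: in_N intro: E_sym)
  moreover have "d y z \<noteq> 0" "d y z \<noteq> 1" using d_eq_0[of y z] d_eq_1[of y z] V assms by auto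
  ultimately have d2: "d y z = 2" by linarith
  have "{w \<in> V. E y w \<and> E z w} = {w \<in> N z. d y w = d y z - 1}"
    using d_eq_1[of y] V unfolding d2 by (auto simp: in_N)
  then show ?thesis using card_down[OF V] d2 by simp
qed

text \<open>The vertex \<open>x\<close> is itself one of the \<open>cs 2\<close> common neighbours
  and lies outside \<open>N x\<close>.\<close>

lemma card_local_common_nbrs:
  assumes "x \<in> V" "y \<in> N x" "z \<in> N x" "y \<noteq> z" "\<not> E y z"
  shows "real (card {w \<in> N x. E y w \<and> E z w}) \<le> \<mu>"
proof -
  have "insert x {w \<in> N x. E y w \<and> E z w} \<subseteq> {w \<in> V. E y w \<and> E z w}"
    using assms by (auto simp: in_N intro: E_sym)
  then have "card (insert x {w \<in> N x. E y w \<and> E z w}) \<le> cs 2"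
    unfolding card_common_nbrs[OF assms, symmetric] by (intro card_mono) auto
  moreover have "x \<notin> {w \<in> N x. E y w \<and> E z w}" by (auto simp: in_N)
  ultimately have "card {w \<in> N x. E y w \<and> E z w} + 1 \<le> cs 2" by simp
  then show ?thesis using cs_2_mu by linarith
qed

section \<open>Maximum independent sets of a local graph and their private neighbourhoods\<close>

definition local_indep :: "'a \<Rightarrow> 'a set \<Rightarrow> bool" where
  "local_indep x I \<longleftrightarrow> I \<subseteq> N x \<and> (\<forall>y\<in>I. \<forall>z\<in>I. \<not> E y z)"

definition priv :: "'a \<Rightarrow> 'a set \<Rightarrow> 'a \<Rightarrow> 'a set" where
  "priv x I z = {y \<in> N x. y = z \<or> E z y \<and> (\<forall>z'\<in>I - {z}. \<not> E z' y)}"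

lemma local_indep_finite: "local_indep x I \<Longrightarrow> finite I"
  unfolding local_indep_def using finite_N finite_subset by blast

lemma ex_max_local_indep:
  "\<exists>I. local_indep x I \<and> (\<forall>J. local_indep x J \<longrightarrow> card J \<le> card I)"
proof -
  have "local_indep x {}" by (simp add: local_indep_def)
  moreover have "\<forall>J. local_indep x J \<longrightarrow> card J < Suc (card (N x))"
    by (auto simp: local_indep_def less_Suc_eq_le intro: card_mono)
  ultimately show ?thesis by (rule ex_has_greatest_nat)
qed

context
  fixes x I
  assumes x: "x \<in> V" and I: "local_indep x I"
    and maxI: "\<And>J. local_indep x J \<Longrightarrow> card J \<le> card I"
begin

lemma finite_I: "finite I" using I by (rule local_indep_finite)

lemma I_props: "z \<in> I \<Longrightarrow> z \<in> N x" "z \<in> I \<Longrightarrow> y \<in> I \<Longrightarrow> \<not> E z y"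
  using I by (auto simp: local_indep_def)

lemma finite_private [simp]: "finite (priv x I z)"
  by (simp add: priv_def)

lemma private_subset: "priv x I z \<subseteq> N x"
  by (auto simp: priv_def)

lemma private_self: "z \<in> I \<Longrightarrow> z \<in> priv x I z"
  using I_props by (auto simp: priv_def)

lemma private_not_adj:
  assumes "z \<in> I" "z' \<in> I" "z \<noteq> z'" "y \<in> priv x I z"
  shows "\<not> E z' y" "y \<noteq> z'"
  using assms I_props(2)[of z z'] I_props(2)[of z' z] by (auto simp: priv_def)

lemma private_disjoint:
  assumes "z \<in> I" "z' \<in> I" "z \<noteq> z'"
  shows "priv x I z \<inter> priv x I z' = {}"
  using private_not_adj[OF assms] by (auto simp: priv_def)

text \<open>Exchange argument: two non-adjacent private neighbours of \<open>z\<close> could replace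
  \<open>z\<close> and enlarge the maximum independent set.\<close>

lemma private_clique:
  assumes z: "z \<in> I" and y: "y \<in> priv x I z" and y': "y' \<in> priv x I z" and ne: "y \<noteq> y'"
  shows "E y y'"
proof (rule ccontr)
  assume nE: "\<not> E y y'"
  have "y \<noteq> z" "y' \<noteq> z" using nE y y' ne by (auto simp: priv_def intro: E_sym)
  then have yz: "E z y" "E z y'" using y y' by (auto simp: priv_def)
  then have nI: "y \<notin> I" "y' \<notin> I" using I_props(2)[OF z] by auto
  let ?J = "insert y (insert y' (I - {z}))"
  have a: "\<not> E z' y" "\<not> E z' y'" "\<not> E y z'" "\<not> E y' z'" if "z' \<in> I - {z}" for z'
    using private_not_adj(1)[OF z _ _ y, of z'] private_not_adj(1)[OF z _ _ y', of z'] that by (auto intro: E_sym)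
  have "\<not> E y' y" using nE E_sym by blast
  then have "local_indep x ?J"
    unfolding local_indep_def using a nE subsetD[OF private_subset y] subsetD[OF private_subset y'] I_props by auto
  then have "card ?J \<le> card I" by (rule maxI)
  moreover have "card ?J = Suc (Suc (card (I - {z})))" using nI ne finite_I by simp
  ultimately show False using z finite_I by (metis Suc_n_not_le_n card_Suc_Diff1)
qed

text \<open>Of the \<open>as 1\<close> neighbours of \<open>z\<close> in \<open>N x\<close>, each
  other member of \<open>I\<close> spoils at most \<mu>. Counting \<open>z\<close> itself gives the
  bound, since \<open>as 1 + 1 \<ge> \<beta>\<close>.\<close>

lemma card_private_ge:
  assumes z: "z \<in> I" shows "real (card (priv x I z)) \<ge> \<beta> - (real (card I) - 1) * \<mu>"
proof -
  let ?A = "\<lambda>z'. {w \<in> N x. E z w \<and> E z' w}"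
  have "{w \<in> N x. E z w} \<subseteq> (priv x I z - {z}) \<union> (\<Union>z'\<in>I - {z}. ?A z')"
    by (auto simp: priv_def)
  then have "card {w \<in> N x. E z w} \<le> card ((priv x I z - {z}) \<union> (\<Union>z'\<in>I - {z}. ?A z'))"
    using finite_I by (intro card_mono) auto
  also have "\<dots> \<le> card (priv x I z - {z}) + (\<Sum>z'\<in>I - {z}. card (?A z'))"
    using finite_I by (intro order.trans[OF card_Un_le] add_mono card_UN_le) auto
  finally have "real (card {w \<in> N x. E z w}) \<le> real (card (priv x I z - {z}) + (\<Sum>z'\<in>I - {z}. card (?A z')))"
    by (rule of_nat_mono)
  then have "real (card {w \<in> N x. E z w}) \<le> real (card (priv x I z - {z})) + (\<Sum>z'\<in>I - {z}. real (card (?A z')))"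
    by (simp only: of_nat_add of_nat_sum)
  also have "(\<Sum>z'\<in>I - {z}. real (card (?A z'))) \<le> (\<Sum>z'\<in>I - {z}. \<mu>)"
    using card_local_common_nbrs[OF x] I_props z by (intro sum_mono) auto
  also have "\<dots> = (real (card I) - 1) * \<mu>"
    using arg_cong[OF card_Suc_Diff1[OF finite_I z], of real] by simp
  also have "real (card (priv x I z - {z})) = real (card (priv x I z)) - 1"
    using card_Suc_Diff1[OF finite_private private_self[OF z]] by simp
  finally have "as 1 + 1 - (real (card I) - 1) * \<mu> \<le> real (card (priv x I z))"
    using card_common_nbrs_edge[OF x I_props(1)[OF z]] by simp
  moreover have "\<alpha> * (r - 1) \<ge> 0" using alpha_nonneg r_ge_q by simp
  ultimately show ?thesis using as_1 by simp
qed

text \<open>The private neighbourhoods are disjoint in \<open>N x\<close>, which bounds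
  \<open>\<beta> * (s - r)\<close> from above for \<open>s = card I\<close>. Between the two roots
  \<open>beta_bound\<close> gives the opposite estimate.\<close>

lemma card_I_lt: "q * real (card I) < (q + 1) * r"
proof (rule ccontr)
  let ?s = "real (card I)"
  assume "\<not> ?thesis"
  then have ge: "q * ?s \<ge> (q + 1) * r" by simp
  have "?s * (\<beta> - (?s - 1) * \<mu>) = (\<Sum>z\<in>I. \<beta> - (?s - 1) * \<mu>)" by simp
  also have "\<dots> \<le> (\<Sum>z\<in>I. real (card (priv x I z)))"
    using card_private_ge by (intro sum_mono) auto
  also have "\<dots> = real (card (\<Union>z\<in>I. priv x I z))"
    using finite_I private_disjoint by (subst card_UN_disjoint) auto
  also have "\<dots> \<le> real (card (N x))"
    using private_subset by (intro of_nat_mono card_mono) auto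
  also have "\<dots> = r * \<beta>" using card_N[OF x] bs_0 by simp
  finally have up: "\<beta> * (?s - r) \<le> \<mu> * ?s\<^sup>2 - \<mu> * ?s" by (simp add: algebra_simps power2_eq_square)
  have mu0: "\<mu> > 0" using mu_ge q_ge by linarith
  have "?s \<le> r * (q + 1)" using independent_card_le[OF x, of I] I by (auto simp: local_indep_def)
  \<comment> \<open>The quadratic with the roots \<open>r * (q + 1) / q\<close> and
    \<open>r * (q + 1)\<close>, nonnegative between them. Expanding it gives the next line.\<close>
  then have "(q * ?s - (q + 1) * r) * (r * (q + 1) - ?s) \<ge> 0" using ge by simp
  then have "q * ?s\<^sup>2 \<le> (q + 1)\<^sup>2 * r * (?s - r)" by (simp add: algebra_simps power2_eq_square)
  then have "\<mu> * (q * ?s\<^sup>2) \<le> \<mu> * ((q + 1)\<^sup>2 * r * (?s - r))" using mu0 by simp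
  also have "\<dots> = (r * \<mu> * (q + 1)\<^sup>2) * (?s - r)" by (simp only: mult_ac)
  also have "\<dots> \<le> (q * \<beta>) * (?s - r)"
  proof (rule mult_right_mono[OF beta_bound])
    have "q * r \<le> q * ?s" using ge r_ge_q by (simp add: algebra_simps)
    then show "0 \<le> ?s - r" using q_ge by simp
  qed
  finally have "q * (\<mu> * ?s\<^sup>2) \<le> q * (\<beta> * (?s - r))" by (simp only: mult_ac)
  then have "\<mu> * ?s\<^sup>2 \<le> \<beta> * (?s - r)" using q_ge by (subst (asm) mult_le_cancel_left_pos) auto
  with up have "\<mu> * ?s \<le> 0" by simp
  moreover have "?s > 0"
  proof -
    have "q * ?s > 0" using ge r_ge_q q_ge by (smt (verit) mult_pos_pos)
    then show ?thesis using q_ge by (simp add: zero_less_mult_iff)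
  qed
  ultimately show False using mu0 by (simp add: mult_le_0_iff)
qed

lemma card_I_mu: "real (card I) * \<mu> * (q + 1) < \<beta>"
proof -
  have "q * real (card I) * (\<mu> * (q + 1)) < (q + 1) * r * (\<mu> * (q + 1))"
    using card_I_lt mu_ge q_ge by (intro mult_strict_right_mono) auto
  also have "\<dots> = r * \<mu> * (q + 1)\<^sup>2" by (simp only: mult_ac power2_eq_square)
  also have "\<dots> \<le> q * \<beta>" by (rule beta_bound)
  finally have "q * (real (card I) * \<mu> * (q + 1)) < q * \<beta>" by (simp only: mult_ac)
  then show ?thesis using q_ge by (subst (asm) mult_less_cancel_left_pos) auto
qed

lemma card_private_large:
  assumes "z \<in> I"
  shows "real (card (priv x I z)) > \<beta> - real (card I) * \<mu>"
    "(q + 1) * real (card (priv x I z)) > q * \<beta>"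
proof -
  show 1: "real (card (priv x I z)) > \<beta> - real (card I) * \<mu>"
    using card_private_ge[OF assms] mu_ge q_ge by (simp add: algebra_simps)
  have "(q + 1) * real (card (priv x I z)) > (q + 1) * (\<beta> - real (card I) * \<mu>)"
    using 1 q_ge by simp
  moreover have "(q + 1) * (\<beta> - real (card I) * \<mu>) = q * \<beta> + (\<beta> - real (card I) * \<mu> * (q + 1))"
    by (simp add: algebra_simps)
  ultimately show "(q + 1) * real (card (priv x I z)) > q * \<beta>"
    using card_I_mu by linarith
qed

text \<open>If \<open>y\<close> missed a vertex of every clique \<open>priv x I z\<close>, one could pick greedily from each of them a
  non-neighbour of \<open>y\<close> so that the choices, together with \<open>y\<close>, form an independent set larger than \<open>I\<close>.\<close>

lemma ex_joined_private:
  assumes y: "y \<in> N x"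
  shows "\<exists>z\<in>I. \<forall>p\<in>priv x I z. p = y \<or> E y p"
proof (rule ccontr)
  assume "\<not> ?thesis"
  then have miss: "\<exists>p\<in>priv x I z. p \<noteq> y \<and> \<not> E y p" if "z \<in> I" for z using that by auto
  have "\<exists>T. local_indep x T \<and> card T = card J \<and> T \<subseteq> (\<Union>z\<in>J. priv x I z) \<and> (\<forall>t\<in>T. t \<noteq> y \<and> \<not> E y t)"
    if "J \<subseteq> I" for J
    using finite_subset[OF that finite_I] that
  proof (induction J rule: finite_induct)
    case empty then show ?case by (intro exI[of _ "{}"]) (auto simp: local_indep_def)
  next
    case (insert z J)
    then obtain T where T: "local_indep x T" "card T = card J" "T \<subseteq> (\<Union>z\<in>J. priv x I z)"
      "\<forall>t\<in>T. t \<noteq> y \<and> \<not> E y t" by auto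
    have fT: "finite T" using T(1) by (rule local_indep_finite)
    have z: "z \<in> I" using insert by auto
    obtain p where p: "p \<in> priv x I z" "p \<noteq> y" "\<not> E y p" using miss z by auto
    \<comment> \<open>Otherwise \<open>y\<close> would be adjacent to \<open>p\<close>, both being
      members of one clique.\<close>
    have yP: "y \<notin> priv x I z" using private_clique[OF z _ p(1)] p by auto
    have far: "\<not> E z t" "t \<noteq> z" "t \<in> N x" if t: "t \<in> T" for t
    proof -
      obtain z' where z': "z' \<in> J" "t \<in> priv x I z'" using T(3) t by auto
      have "z' \<in> I" "z' \<noteq> z" using z' insert by auto
      then show "\<not> E z t" "t \<noteq> z" "t \<in> N x"
        using private_not_adj[of z' z t] z z' private_subset by auto
    qed
    \<comment> \<open>Members of the clique adjacent to \<open>y\<close> lie in \<open>?A\<close>,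
      since they are adjacent to \<open>p\<close> too; those adjacent to some
      \<open>t \<in> T\<close> lie in \<open>?B t\<close>, since they are adjacent to
      \<open>z\<close> too. These sets cannot cover the clique, and any vertex left over extends
      \<open>T\<close>.\<close>
    let ?A = "{w \<in> N x. E p w \<and> E y w}"
    let ?B = "\<lambda>t. {w \<in> N x. E t w \<and> E z w}"
    have pN: "p \<in> N x" using p private_subset by auto
    have "real (card (?A \<union> (\<Union>t\<in>T. ?B t))) \<le> real (card ?A + (\<Sum>t\<in>T. card (?B t)))"
      using fT by (intro of_nat_mono order.trans[OF card_Un_le] add_mono card_UN_le) auto
    also have "\<dots> = real (card ?A) + (\<Sum>t\<in>T. real (card (?B t)))" by simp
    also have "\<dots> \<le> \<mu> + (\<Sum>t\<in>T. \<mu>)"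
    proof (intro add_mono sum_mono)
      show "real (card ?A) \<le> \<mu>" using p pN y by (intro card_local_common_nbrs[OF x]) (auto intro: E_sym)
      fix t assume "t \<in> T"
      then show "real (card (?B t)) \<le> \<mu>"
        using far[of t] I_props(1)[OF z] by (intro card_local_common_nbrs[OF x]) (auto intro: E_sym)
    qed
    also have "\<dots> = real (card (insert z J)) * \<mu>" using T(2) insert by (simp add: algebra_simps)
    also have "\<dots> \<le> real (card I) * \<mu>"
      using insert.prems finite_I mu_ge q_ge by (intro mult_right_mono of_nat_mono card_mono) auto
    also have "\<dots> < real (card (priv x I z))"
    proof -
      have "real (card I) * \<mu> * 2 \<le> real (card I) * \<mu> * (q + 1)"
        using mu_ge q_ge by (intro mult_left_mono) auto
      then show ?thesis using card_I_mu card_private_large(1)[OF z] by linarith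
    qed
    finally have lt: "card (?A \<union> (\<Union>t\<in>T. ?B t)) < card (priv x I z)" by simp
    have "\<not> priv x I z \<subseteq> ?A \<union> (\<Union>t\<in>T. ?B t)"
    proof
      assume "priv x I z \<subseteq> ?A \<union> (\<Union>t\<in>T. ?B t)"
      then have "card (priv x I z) \<le> card (?A \<union> (\<Union>t\<in>T. ?B t))"
        using fT by (intro card_mono) auto
      then show False using lt by simp
    qed
    then obtain v where v: "v \<in> priv x I z" "v \<notin> ?A" "\<And>t. t \<in> T \<Longrightarrow> v \<notin> ?B t" by auto
    have vN: "v \<in> N x" using v private_subset by auto
    have yv: "\<not> E y v"
    proof
      assume "E y v"
      then have "v \<noteq> p" using p by auto
      then have "E p v" using private_clique[OF z p(1) v(1)] by auto
      then show False using v(2) vN \<open>E y v\<close> by auto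
    qed
    have tv: "\<not> E t v" if "t \<in> T" for t
    proof
      assume "E t v"
      then have "v \<noteq> z" using far[OF that] by (auto intro: E_sym)
      then have "E z v" using private_clique[OF z private_self[OF z] v(1)] by auto
      then show False using v(3)[OF that] vN \<open>E t v\<close> by auto
    qed
    have vT: "v \<notin> T"
    proof
      assume "v \<in> T"
      then obtain z' where z': "z' \<in> J" "v \<in> priv x I z'" using T(3) by auto
      then show False using private_disjoint[of z' z] z insert v(1) by auto
    qed
    have "local_indep x (insert v T)"
      using T(1) tv vN unfolding local_indep_def by (auto intro: E_sym)
    moreover have "card (insert v T) = card (insert z J)" using vT fT T(2) insert by simp
    moreover have "insert v T \<subseteq> (\<Union>z\<in>insert z J. priv x I z)" using T(3) v(1) by auto
    moreover have "\<forall>t\<in>insert v T. t \<noteq> y \<and> \<not> E y t" using T(4) yv yP v(1) by auto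
    ultimately show ?case by blast
  qed
  from this[OF subset_refl] obtain T where T: "local_indep x T" "card T = card I"
    "\<forall>t\<in>T. t \<noteq> y \<and> \<not> E y t" by auto
  have "local_indep x (insert y T)" using T y unfolding local_indep_def by (auto intro: E_sym)
  then have "card (insert y T) \<le> card I" by (rule maxI)
  moreover have "y \<notin> T" using T(3) by auto
  ultimately show False using T(2) local_indep_finite[OF T(1)] by simp
qed

end

section \<open>Big cliques and lines\<close>

definition big_clique :: "'a set \<Rightarrow> bool" where
  "big_clique C \<longleftrightarrow> is_clique V E C \<and> (q + 1) * (real (card C) - 1) > q * \<beta>"

lemma clique_finite: "is_clique V E C \<Longrightarrow> finite C"
  unfolding is_clique_def using finite_V finite_subset by blast

text \<open>Take \<open>x\<close>, \<open>y\<close> and a private neighbourhood joined to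
  \<open>y\<close>. The vertex \<open>x\<close> accounts for the 1 subtracted in
  \<open>big_clique\<close>; \<open>y\<close> may already be a private neighbour and is not
  counted.\<close>

lemma edge_in_big_clique:
  assumes x: "x \<in> V" and y: "y \<in> N x"
  shows "\<exists>C. big_clique C \<and> x \<in> C \<and> y \<in> C"
proof -
  obtain I where I: "local_indep x I" "\<And>J. local_indep x J \<Longrightarrow> card J \<le> card I"
    using ex_max_local_indep by blast
  obtain z where z: "z \<in> I" "\<forall>p\<in>priv x I z. p = y \<or> E y p"
    using ex_joined_private[OF x I y] by auto
  let ?P = "priv x I z"
  let ?C = "insert x (insert y ?P)"
  have PN: "insert y ?P \<subseteq> N x" using private_subset[OF x I] y by auto
  have adj: "E p p'" if "p \<in> ?P" "p' \<in> ?P" "p \<noteq> p'" for p p'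
    using private_clique[OF x I z(1)] that by auto
  have y_adj: "E y p" "E p y" if "p \<in> ?P" "p \<noteq> y" for p
    using z(2) that E_sym by blast+
  have x_adj: "E x p" "E p x" "p \<in> V" if "p \<in> insert y ?P" for p
    using subsetD[OF PN that] E_sym by (auto simp: in_N)
  have "is_clique V E ?C"
    unfolding is_clique_def using x x_adj y_adj adj by auto
  moreover have "card ?C \<ge> Suc (card ?P)"
  proof -
    have "x \<notin> insert y ?P" using PN by (auto simp: in_N)
    moreover have "finite (insert y ?P)" using PN finite_N by (rule finite_subset)
    ultimately show ?thesis by (auto simp: card_insert_if)
  qed
  then have "(q + 1) * real (card ?P) \<le> (q + 1) * (real (card ?C) - 1)"
    using q_ge by (intro mult_left_mono) auto
  ultimately have "big_clique ?C"
    unfolding big_clique_def using card_private_large(2)[OF x I z(1)] by linarith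
  then show ?thesis by blast
qed

text \<open>A non-adjacent pair across the two cliques would force a small intersection, while the
  edge \<open>x y\<close> keeps the union small. The sum of the two sizes would then be too small
  for big cliques.\<close>

lemma big_clique_union:
  assumes C: "big_clique C" "big_clique C'" and x: "x \<in> C" "x \<in> C'" and y: "y \<in> C" "y \<in> C'" and ne: "x \<noteq> y"
  shows "is_clique V E (C \<union> C')"
proof -
  have cl: "is_clique V E C" "is_clique V E C'" using C by (auto simp: big_clique_def)
  note fin = cl[THEN clique_finite]
  have xV: "x \<in> V" "y \<in> N x" using cl x y ne by (auto simp: is_clique_def in_N)
  have small: "E a c" if a: "a \<in> C" and c: "c \<in> C'" and ac: "a \<noteq> c" for a c
  proof (rule ccontr)
    assume nE: "\<not> E a c"
    have "a \<notin> C'" "c \<notin> C" using nE a c ac cl by (auto simp: is_clique_def)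
    then have aN: "a \<in> N x" "c \<in> N x" "a \<noteq> x" "c \<noteq> x" using a c x cl by (auto simp: is_clique_def in_N)
    \<comment> \<open>Every vertex of the intersection is adjacent to both \<open>a\<close> and
      \<open>c\<close>, which lie outside it.\<close>
    have "C \<inter> C' \<subseteq> {w \<in> V. E a w \<and> E c w}"
      using cl a c \<open>a \<notin> C'\<close> \<open>c \<notin> C\<close> by (auto simp: is_clique_def)
    then have "card (C \<inter> C') \<le> cs 2"
      unfolding card_common_nbrs[OF xV(1) aN(1,2) ac nE, symmetric] by (intro card_mono) auto
    then have i: "real (card (C \<inter> C')) \<le> \<mu> + 1" using cs_2_mu by linarith
    have "C \<union> C' \<subseteq> insert x (insert y {z \<in> N x. E y z})"
      using cl x y by (auto simp: is_clique_def in_N)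
    then have "card (C \<union> C') \<le> card (insert x (insert y {z \<in> N x. E y z}))"
      by (intro card_mono) auto
    also have "\<dots> \<le> card {z \<in> N x. E y z} + 2" by (simp add: card_insert_if)
    finally have un: "real (card (C \<union> C')) \<le> as 1 + 2" using card_common_nbrs_edge[OF xV] by linarith
    have "real (card C) + real (card C') = real (card (C \<union> C')) + real (card (C \<inter> C'))"
      using card_Un_Int[OF fin] by linarith
    then have "(real (card C) - 1) + (real (card C') - 1) \<le> \<beta> + \<alpha> * (r - 1) + \<mu>"
      using i un as_1 by linarith
    then have "(q + 1) * ((real (card C) - 1) + (real (card C') - 1)) \<le> (q + 1) * (\<beta> + \<alpha> * (r - 1) + \<mu>)"
      using q_ge by (intro mult_left_mono) auto
    moreover have "q * \<beta> + q * \<beta> < (q + 1) * ((real (card C) - 1) + (real (card C') - 1))"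
      unfolding distrib_left using C unfolding big_clique_def by linarith
    ultimately have "q * \<beta> + q * \<beta> < (q + 1) * (\<beta> + \<alpha> * (r - 1) + \<mu>)" by linarith
    then have less: "(q - 1) * \<beta> < \<alpha> * (q + 1) * (r - 1) + (q + 1) * \<mu>" by (simp add: algebra_simps)
    \<comment> \<open>From \<open>\<alpha> * (q + 1) \<le> \<mu>\<close>. The right side ends up at
      most \<open>2 * r * \<mu>\<close>, below \<beta>.\<close>
    also have "\<dots> \<le> \<mu> * (r - 1) + (q + 1) * \<mu>"
      using mu_ge r_ge_q q_ge by (intro add_mono mult_right_mono) auto
    also have "\<dots> = r * \<mu> + q * \<mu>" by (simp add: algebra_simps)
    also have "\<dots> \<le> r * \<mu> + r * \<mu>" using r_ge_q mu_ge q_ge by (intro add_mono mult_right_mono) auto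
    also have "\<dots> \<le> 9/2 * (r * \<mu>)" using r_ge_q mu_ge q_ge by simp
    also have "\<dots> \<le> \<beta>" by (rule beta_ge)
    also have "\<dots> \<le> (q - 1) * \<beta>" using q_ge beta_ge_r by simp
    finally show False by simp
  qed
  have small': "E c a" if "a \<in> C" "c \<in> C'" "a \<noteq> c" for a c
    using small[OF that] by (rule E_sym)
  show ?thesis using cl small small' unfolding is_clique_def by (metis Un_iff le_sup_iff)
qed

definition lines :: "'a set set" where
  "lines = {C. big_clique C \<and> (\<forall>C'. is_clique V E C' \<and> C \<subseteq> C' \<longrightarrow> C' = C)}"

lemma finite_lines: "finite lines"
  by (rule finite_subset[of _ "Pow V"]) (auto simp: lines_def big_clique_def is_clique_def)

lemma line_clique: "L \<in> lines \<Longrightarrow> is_clique V E L"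
  by (simp add: lines_def big_clique_def)

lemma line_card: "L \<in> lines \<Longrightarrow> (q + 1) * (real (card L) - 1) > q * \<beta>"
  by (simp add: lines_def big_clique_def)

text \<open>A largest clique containing a big one is a line. Two lines on the same edge have a
  clique as union, so by maximality both equal it.\<close>

lemma ex1_line:
  assumes x: "x \<in> V" and y: "y \<in> N x"
  shows "\<exists>!L. L \<in> lines \<and> x \<in> L \<and> y \<in> L"
proof -
  obtain C where C: "big_clique C" "x \<in> C" "y \<in> C" using edge_in_big_clique[OF assms] by auto
  have "\<exists>L. (is_clique V E L \<and> C \<subseteq> L) \<and> (\<forall>C'. is_clique V E C' \<and> C \<subseteq> C' \<longrightarrow> card C' \<le> card L)"
  proof (rule ex_has_greatest_nat)
    show "is_clique V E C \<and> C \<subseteq> C" using C by (simp add: big_clique_def)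
    show "\<forall>C'. is_clique V E C' \<and> C \<subseteq> C' \<longrightarrow> card C' < Suc (card V)"
      by (auto simp: is_clique_def less_Suc_eq_le intro: card_mono)
  qed
  then obtain L where L: "is_clique V E L" "C \<subseteq> L" "\<And>C'. is_clique V E C' \<Longrightarrow> C \<subseteq> C' \<Longrightarrow> card C' \<le> card L"
    by blast
  have "card C \<le> card L" using L clique_finite by (intro card_mono) auto
  then have "(q + 1) * (real (card C) - 1) \<le> (q + 1) * (real (card L) - 1)"
    using q_ge by (intro mult_left_mono) auto
  then have "big_clique L" using C L by (simp add: big_clique_def)
  moreover have "C' = L" if "is_clique V E C'" "L \<subseteq> C'" for C'
  proof -
    have "card C' \<le> card L" using L that by auto
    then show ?thesis using that clique_finite card_seteq by blast
  qed
  ultimately have "L \<in> lines" by (auto simp: lines_def)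
  moreover have "M = M'" if "M \<in> lines" "M' \<in> lines" "x \<in> M" "x \<in> M'" "y \<in> M" "y \<in> M'" for M M'
  proof -
    have "x \<noteq> y" using y by (auto simp: in_N)
    then have "is_clique V E (M \<union> M')" using that by (intro big_clique_union[of M M' x y]) (auto simp: lines_def)
    then have "M \<union> M' = M" "M \<union> M' = M'" using that unfolding lines_def by blast+
    then show ?thesis by simp
  qed
  ultimately show ?thesis using C L by blast
qed

end

section \<open>All lines are Delsarte cliques\<close>

text \<open>\<open>R\<close> is the projection onto the part of the image of \<open>P\<close>
  orthogonal to all \<open>m \<in> F\<close>. Each further \<open>m\<close> costs one rank-one
  projection, whose trace over any set of points is at most 1.\<close>

lemma projection_deflation:
  fixes P :: "'a \<Rightarrow> 'a \<Rightarrow> real"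
  assumes V: "finite V" and B: "B \<subseteq> V" and F: "finite F"
    and sym: "\<And>x y. x \<in> V \<Longrightarrow> y \<in> V \<Longrightarrow> P x y = P y x"
    and idem: "\<And>x y. x \<in> V \<Longrightarrow> y \<in> V \<Longrightarrow> (\<Sum>z\<in>V. P x z * P z y) = P x y"
  shows "\<exists>R. (\<forall>x\<in>V. \<forall>y\<in>V. R x y = R y x) \<and>
    (\<forall>x\<in>V. \<forall>y\<in>V. (\<Sum>z\<in>V. R x z * R z y) = R x y) \<and>
    (\<forall>x\<in>V. \<forall>y\<in>V. (\<Sum>z\<in>V. P x z * R z y) = R x y) \<and>
    (\<forall>m\<in>F. \<forall>x\<in>V. (\<Sum>y\<in>V. R x y * m y) = 0) \<and>
    (\<Sum>x\<in>B. R x x) \<ge> (\<Sum>x\<in>B. P x x) - real (card F)"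
  using F
proof (induction F rule: finite_induct)
  case empty
  then show ?case using sym idem by (intro exI[of _ P]) auto
next
  case (insert m F)
  then obtain R where Rsym: "\<And>x y. x \<in> V \<Longrightarrow> y \<in> V \<Longrightarrow> R x y = R y x"
    and RR: "\<And>x y. x \<in> V \<Longrightarrow> y \<in> V \<Longrightarrow> (\<Sum>z\<in>V. R x z * R z y) = R x y"
    and PR: "\<And>x y. x \<in> V \<Longrightarrow> y \<in> V \<Longrightarrow> (\<Sum>z\<in>V. P x z * R z y) = R x y"
    and RF: "\<And>m x. m \<in> F \<Longrightarrow> x \<in> V \<Longrightarrow> (\<Sum>y\<in>V. R x y * m y) = 0"
    and tr: "(\<Sum>x\<in>B. R x x) \<ge> (\<Sum>x\<in>B. P x x) - real (card F)"
    by blast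
  \<comment> \<open>\<open>h\<close> is the projection of \<open>m\<close>. If it vanishes,
    \<open>R\<close> is kept; otherwise the projection onto the line spanned by \<open>h\<close> is
    subtracted.\<close>
  define h where "h x = (\<Sum>y\<in>V. R x y * m y)" for x
  define n where "n = (\<Sum>x\<in>V. (h x)\<^sup>2)"
  have fix_h: "(\<Sum>z\<in>V. S x z * h z) = h x"
    if "\<And>y. y \<in> V \<Longrightarrow> (\<Sum>z\<in>V. S x z * R z y) = R x y" for S x
  proof -
    have "(\<Sum>z\<in>V. S x z * h z) = (\<Sum>z\<in>V. \<Sum>y\<in>V. S x z * R z y * m y)"
      by (simp add: h_def sum_distrib_left mult.assoc)
    also have "\<dots> = (\<Sum>y\<in>V. \<Sum>z\<in>V. S x z * R z y * m y)" by (rule sum.swap)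
    also have "\<dots> = (\<Sum>y\<in>V. (\<Sum>z\<in>V. S x z * R z y) * m y)" by (simp add: sum_distrib_right)
    also have "\<dots> = h x" using that by (simp add: h_def)
    finally show ?thesis .
  qed
  have Rh: "(\<Sum>z\<in>V. R x z * h z) = h x" if "x \<in> V" for x using RR that by (intro fix_h) auto
  have Ph: "(\<Sum>z\<in>V. P x z * h z) = h x" if "x \<in> V" for x using PR that by (intro fix_h) auto
  have hR: "(\<Sum>z\<in>V. h z * R z y) = h y" if "y \<in> V" for y
    using Rh[OF that] Rsym that by (simp add: mult.commute)
  have hm: "(\<Sum>x\<in>V. h x * m' x) = (\<Sum>y\<in>V. m y * (\<Sum>x\<in>V. R y x * m' x))" for m'
  proof -
    have "(\<Sum>x\<in>V. h x * m' x) = (\<Sum>x\<in>V. \<Sum>y\<in>V. R x y * m y * m' x)"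
      by (simp add: h_def sum_distrib_right)
    also have "\<dots> = (\<Sum>y\<in>V. \<Sum>x\<in>V. R x y * m y * m' x)" by (rule sum.swap)
    also have "\<dots> = (\<Sum>y\<in>V. \<Sum>x\<in>V. m y * (R y x * m' x))"
      using Rsym by (intro sum.cong refl) (simp add: mult_ac)
    finally show ?thesis by (simp add: sum_distrib_left)
  qed
  show ?case
  proof (cases "n = 0")
    case True
    then have "h x = 0" if "x \<in> V" for x
      using that V unfolding n_def by (subst (asm) sum_nonneg_eq_0_iff) auto
    then have "\<forall>m\<in>insert m F. \<forall>x\<in>V. (\<Sum>y\<in>V. R x y * m y) = 0" using RF by (auto simp: h_def)
    moreover have "(\<Sum>x\<in>B. R x x) \<ge> (\<Sum>x\<in>B. P x x) - real (card (insert m F))"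
      using tr insert by simp
    ultimately show ?thesis using Rsym RR PR by blast
  next
    case False
    moreover have "n \<ge> 0" unfolding n_def by (intro sum_nonneg) auto
    ultimately have n: "n > 0" by simp
    define R' where "R' x y = R x y - h x * h y / n" for x y
    have hmn: "(\<Sum>x\<in>V. h x * m x) = n"
    proof -
      have "(\<Sum>x\<in>V. h x * m x) = (\<Sum>x\<in>V. m x * h x)" by (simp add: mult.commute)
      also have "\<dots> = (\<Sum>y\<in>V. m y * (\<Sum>x\<in>V. R y x * h x))" using Rh by simp
      also have "\<dots> = (\<Sum>x\<in>V. h x * h x)" by (rule hm[symmetric])
      finally show ?thesis by (simp add: n_def power2_eq_square)
    qed
    have "R' x y = R' y x" if "x \<in> V" "y \<in> V" for x y using Rsym that by (simp add: R'_def mult.commute)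
    moreover have PR': "(\<Sum>z\<in>V. S x z * R' z y) = R' x y"
      if "\<And>y. y \<in> V \<Longrightarrow> (\<Sum>z\<in>V. S x z * R z y) = R x y" "(\<Sum>z\<in>V. S x z * h z) = h x" "y \<in> V" for S x y
    proof -
      have "(\<Sum>z\<in>V. S x z * R' z y) = (\<Sum>z\<in>V. S x z * R z y) - (\<Sum>z\<in>V. S x z * h z) * h y / n"
        by (simp add: R'_def right_diff_distrib sum_subtractf sum_distrib_right sum_divide_distrib mult.assoc)
      then show ?thesis using that by (simp add: R'_def)
    qed
    moreover have "(\<Sum>z\<in>V. R' x z * R' z y) = R' x y" if "x \<in> V" "y \<in> V" for x y
    proof -
      have hR': "(\<Sum>z\<in>V. h z * R' z y) = 0"
      proof -
        have "(\<Sum>z\<in>V. h z * R' z y) = (\<Sum>z\<in>V. h z * R z y) - (\<Sum>z\<in>V. h z * h z) * h y / n"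
          by (simp add: R'_def right_diff_distrib sum_subtractf sum_distrib_right sum_divide_distrib mult.assoc)
        also have "(\<Sum>z\<in>V. h z * h z) = n" by (simp add: n_def power2_eq_square)
        finally show ?thesis using hR that n by simp
      qed
      have "(\<Sum>z\<in>V. R' x z * R' z y) = (\<Sum>z\<in>V. R x z * R' z y) - h x / n * (\<Sum>z\<in>V. h z * R' z y)"
      proof -
        have "R' x z * R' z y = R x z * R' z y - h x / n * (h z * R' z y)" for z
          by (simp add: R'_def[of x] left_diff_distrib)
        then show ?thesis by (simp only: sum_subtractf sum_distrib_left)
      qed
      then show ?thesis using hR' PR'[of R x y, OF RR[OF that(1)] Rh[OF that(1)] that(2)] by simp
    qed
    moreover have "(\<Sum>y\<in>V. R' x y * m' y) = 0" if "m' \<in> insert m F" "x \<in> V" for m' x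
    proof -
      have *: "(\<Sum>y\<in>V. R' x y * m' y) = (\<Sum>y\<in>V. R x y * m' y) - h x / n * (\<Sum>y\<in>V. h y * m' y)"
      proof -
        have "R' x y * m' y = R x y * m' y - h x / n * (h y * m' y)" for y
          by (simp add: R'_def left_diff_distrib)
        then show ?thesis by (simp only: sum_subtractf sum_distrib_left)
      qed
      show ?thesis
      proof (cases "m' = m")
        case True
        then show ?thesis using * hmn n by (simp add: h_def)
      next
        case False
        then have "m' \<in> F" using that by auto
        then show ?thesis using * hm[of m'] RF that by simp
      qed
    qed
    moreover have "(\<Sum>x\<in>B. R' x x) \<ge> (\<Sum>x\<in>B. P x x) - real (card (insert m F))"
    proof -
      have "(\<Sum>x\<in>B. R' x x) = (\<Sum>x\<in>B. R x x) - (\<Sum>x\<in>B. (h x)\<^sup>2) / n"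
        by (simp add: R'_def sum_subtractf sum_divide_distrib power2_eq_square)
      moreover have "(\<Sum>x\<in>B. (h x)\<^sup>2) \<le> n"
        unfolding n_def using V B by (intro sum_mono2) auto
      then have "(\<Sum>x\<in>B. (h x)\<^sup>2) / n \<le> 1" using n by simp
      ultimately show ?thesis using tr insert by simp
    qed
    ultimately show ?thesis using PR Ph by (intro exI[of _ R']) auto
  qed
qed

context distance_regular_graph
begin

section \<open>Orthogonality of eigenfunctions and finiteness of the spectrum\<close>

lemma eigenfun_orthogonal:
  assumes "eigenfun \<theta> f" "eigenfun \<eta> g" "\<theta> \<noteq> \<eta>"
  shows "(\<Sum>x\<in>V. f x * g x) = 0"
proof -
  have "\<eta> * (\<Sum>x\<in>V. f x * g x) = (\<Sum>x\<in>V. f x * (\<Sum>y\<in>N x. g y))"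
    using assms(2) by (simp add: eigenfun_def sum_distrib_left mult_ac)
  also have "\<dots> = (\<Sum>x\<in>V. \<Sum>y\<in>N x. f x * g y)" by (simp add: sum_distrib_left)
  also have "\<dots> = (\<Sum>y\<in>V. \<Sum>x\<in>N y. f x * g y)" by (rule sum_N_swap)
  also have "\<dots> = (\<Sum>y\<in>V. (\<Sum>x\<in>N y. f x) * g y)" by (simp add: sum_distrib_right)
  also have "\<dots> = \<theta> * (\<Sum>x\<in>V. f x * g x)"
    using assms(1) by (simp add: eigenfun_def sum_distrib_left mult_ac)
  finally show ?thesis using assms(3) by simp
qed

text \<open>Needed because \<open>theta_min\<close> is a \<open>Min\<close>. Normalised
  eigenfunctions for distinct eigenvalues are orthonormal; summing Bessel's inequality over the
  point indicators bounds their number by \<open>card V\<close>.\<close>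

lemma finite_eigenvalues: "finite {\<theta>. adj_eigenvalue V E \<theta>}"
proof -
  have "card T \<le> card V" if T: "T \<subseteq> {\<theta>. adj_eigenvalue V E \<theta>}" "finite T" for T
  proof -
    have "\<exists>f. eigenfun \<theta> f \<and> (\<Sum>x\<in>V. (f x)\<^sup>2) = 1" if "\<theta> \<in> T" for \<theta>
    proof -
      have "adj_eigenvalue V E \<theta>" using T(1) that by blast
      then obtain g x where g: "eigenfun \<theta> g" "x \<in> V" "g x \<noteq> 0"
        unfolding adj_eigenvalue_def eigenfun_def by blast
      define s where "s = (\<Sum>x\<in>V. (g x)\<^sup>2)"
      have "(g x)\<^sup>2 \<le> s" unfolding s_def using g by (intro member_le_sum) auto
      then have s: "s > 0" using g(3) by (smt (verit) zero_less_power2)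
      have "eigenfun \<theta> (\<lambda>x. g x / sqrt s)"
        using g(1) by (simp add: eigenfun_def flip: sum_divide_distrib)
      moreover have "(\<Sum>x\<in>V. (g x / sqrt s)\<^sup>2) = 1"
      proof -
        have "(\<Sum>x\<in>V. (g x / sqrt s)\<^sup>2) = (\<Sum>x\<in>V. (g x)\<^sup>2 / s)"
          using s by (simp add: power_divide)
        also have "\<dots> = s / s" by (simp only: s_def sum_divide_distrib)
        finally show ?thesis using s by simp
      qed
      ultimately show ?thesis by blast
    qed
    then obtain f where f: "\<And>\<theta>. \<theta> \<in> T \<Longrightarrow> eigenfun \<theta> (f \<theta>)" "\<And>\<theta>. \<theta> \<in> T \<Longrightarrow> (\<Sum>x\<in>V. (f \<theta> x)\<^sup>2) = 1"
      by metis
    have inner: "(\<Sum>y\<in>V. f \<theta> y * f \<eta> y) = (if \<theta> = \<eta> then 1 else 0)" if "\<theta> \<in> T" "\<eta> \<in> T" for \<theta> \<eta>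
      using f that eigenfun_orthogonal[of \<theta> "f \<theta>" \<eta> "f \<eta>"] by (auto simp: power2_eq_square)
    have bessel: "(\<Sum>\<theta>\<in>T. (f \<theta> x)\<^sup>2) \<le> 1" if x: "x \<in> V" for x
    proof -
      \<comment> \<open>The projection of the indicator of \<open>x\<close> onto the span of the
        eigenfunctions; the squared norm of the difference is \<open>1 - p x\<close>.\<close>
      define p where "p y = (\<Sum>\<theta>\<in>T. f \<theta> x * f \<theta> y)" for y
      have pp: "(\<Sum>y\<in>V. (p y)\<^sup>2) = p x"
      proof -
        have "(\<Sum>y\<in>V. (p y)\<^sup>2) = (\<Sum>y\<in>V. \<Sum>\<theta>\<in>T. \<Sum>\<eta>\<in>T. (f \<theta> x * f \<theta> y) * (f \<eta> x * f \<eta> y))"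
          by (simp add: p_def power2_eq_square sum_product)
        also have "\<dots> = (\<Sum>\<theta>\<in>T. \<Sum>y\<in>V. \<Sum>\<eta>\<in>T. (f \<theta> x * f \<theta> y) * (f \<eta> x * f \<eta> y))" by (rule sum.swap)
        also have "\<dots> = (\<Sum>\<theta>\<in>T. \<Sum>\<eta>\<in>T. \<Sum>y\<in>V. (f \<theta> x * f \<theta> y) * (f \<eta> x * f \<eta> y))"
          by (intro sum.cong refl sum.swap)
        also have "\<dots> = (\<Sum>\<theta>\<in>T. \<Sum>\<eta>\<in>T. f \<theta> x * f \<eta> x * (\<Sum>y\<in>V. f \<theta> y * f \<eta> y))"
          by (simp add: sum_distrib_left mult_ac)
        also have "\<dots> = (\<Sum>\<theta>\<in>T. \<Sum>\<eta>\<in>T. if \<theta> = \<eta> then f \<theta> x * f \<eta> x else 0)"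
          using inner by (intro sum.cong refl) simp
        also have "\<dots> = p x" using T(2) by (simp add: p_def sum.delta)
        finally show ?thesis .
      qed
      have "0 \<le> (\<Sum>y\<in>V. ((if y = x then 1 else 0) - p y)\<^sup>2)" by (intro sum_nonneg) auto
      also have "\<dots> = (\<Sum>y\<in>V. (if y = x then 1 - 2 * p y else 0) + (p y)\<^sup>2)"
        by (intro sum.cong) (auto simp: power2_eq_square algebra_simps)
      also have "\<dots> = 1 - p x" using x pp by (simp add: sum.distrib)
      finally show ?thesis by (simp add: p_def power2_eq_square)
    qed
    have "real (card T) = (\<Sum>\<theta>\<in>T. \<Sum>x\<in>V. (f \<theta> x)\<^sup>2)" using f by simp
    also have "\<dots> = (\<Sum>x\<in>V. \<Sum>\<theta>\<in>T. (f \<theta> x)\<^sup>2)" by (rule sum.swap)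
    also have "\<dots> \<le> (\<Sum>x\<in>V. 1)" using bessel by (intro sum_mono) auto
    finally show ?thesis by simp
  qed
  then show ?thesis using finite_if_finite_subsets_card_bdd by blast
qed

end

context large_classical_graph
begin

section \<open>Lines through a point and deficient lines\<close>

definition lines_at :: "'a \<Rightarrow> 'a set set" where
  "lines_at x = {L \<in> lines. x \<in> L}"

lemma finite_lines_at [simp]: "finite (lines_at x)"
  using finite_lines by (simp add: lines_at_def)

text \<open>The lines through \<open>x\<close>, with \<open>x\<close> removed, partition
  \<open>N x\<close>.\<close>

lemma sum_lines_at:
  fixes f :: "'a \<Rightarrow> real"
  assumes x: "x \<in> V"
  shows "(\<Sum>L\<in>lines_at x. \<Sum>y\<in>L. f y) = real (card (lines_at x)) * f x + (\<Sum>y\<in>N x. f y)"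
proof -
  have N: "N x = (\<Union>L\<in>lines_at x. L - {x})"
  proof (intro equalityI subsetI)
    fix y assume y: "y \<in> N x"
    obtain L where "L \<in> lines" "x \<in> L" "y \<in> L" using ex1_line[OF x y] by blast
    then show "y \<in> (\<Union>L\<in>lines_at x. L - {x})" using y by (auto simp: lines_at_def in_N)
  next
    fix y assume "y \<in> (\<Union>L\<in>lines_at x. L - {x})"
    then show "y \<in> N x" using line_clique by (auto simp: lines_at_def is_clique_def in_N)
  qed
  have disj: "(L - {x}) \<inter> (M - {x}) = {}" if "L \<in> lines_at x" "M \<in> lines_at x" "L \<noteq> M" for L M
  proof (rule ccontr)
    assume "\<not> ?thesis"
    then obtain y where y: "y \<in> L" "y \<in> M" "y \<noteq> x" by auto
    then have yN: "y \<in> N x" unfolding N using that(1) by blast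
    have "L \<in> lines" "x \<in> L" "M \<in> lines" "x \<in> M" using that by (simp_all add: lines_at_def)
    then show False using ex1_line[OF x yN] y that(3) by blast
  qed
  have fin: "finite L" if "L \<in> lines_at x" for L
    using that line_clique clique_finite by (auto simp: lines_at_def)
  have "(\<Sum>y\<in>N x. f y) = (\<Sum>L\<in>lines_at x. \<Sum>y\<in>L - {x}. f y)"
    unfolding N using fin disj by (intro sum.UNION_disjoint) auto
  moreover have "(\<Sum>L\<in>lines_at x. \<Sum>y\<in>L. f y) = (\<Sum>L\<in>lines_at x. f x + (\<Sum>y\<in>L - {x}. f y))"
    using fin by (intro sum.cong refl sum.remove) (auto simp: lines_at_def)
  ultimately show ?thesis by (simp add: sum.distrib)
qed

lemma sum_card_lines_at:
  assumes "x \<in> V" shows "(\<Sum>L\<in>lines_at x. real (card L) - 1) = r * \<beta>"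
proof -
  have "(\<Sum>L\<in>lines_at x. real (card L)) = real (card (lines_at x)) + real (card (N x))"
    using sum_lines_at[OF assms, of "\<lambda>_. 1"] by simp
  also have "real (card (N x)) = r * \<beta>" unfolding card_N[OF assms] by (rule bs_0)
  finally show ?thesis by (simp add: sum_subtractf)
qed

lemma card_lines_at_le:
  assumes x: "x \<in> V" shows "q * real (card (lines_at x)) \<le> (q + 1) * r"
proof -
  have "(\<Sum>L\<in>lines_at x. q * \<beta>) \<le> (\<Sum>L\<in>lines_at x. (q + 1) * (real (card L) - 1))"
    by (intro sum_mono less_imp_le line_card) (simp add: lines_at_def)
  then have "real (card (lines_at x)) * (q * \<beta>) \<le> (q + 1) * (r * \<beta>)"
    unfolding sum_distrib_left[symmetric] sum_card_lines_at[OF x] by (simp add: mult.left_commute)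
  then have "\<beta> * (q * real (card (lines_at x))) \<le> \<beta> * ((q + 1) * r)" by (simp only: mult_ac)
  then show ?thesis using beta_ge_r by simp
qed

definition bad_lines :: "'a set set" where
  "bad_lines = {L \<in> lines. real (card L) \<noteq> \<beta> + 1}"

text \<open>The numbers \<open>card L - 1\<close> over the lines through \<open>x\<close> add up to
  \<open>r * \<beta>\<close>, none exceeds \<beta>, and a bad line falls short of it.\<close>

lemma card_lines_at_bad:
  assumes L: "L \<in> bad_lines" "x \<in> L"
  shows "real (card (lines_at x)) > r"
proof -
  have x: "x \<in> V" using L line_clique by (auto simp: bad_lines_def is_clique_def)
  have "r * \<beta> = (\<Sum>L\<in>lines_at x. real (card L) - 1)" using sum_card_lines_at[OF x] by simp
  also have "\<dots> < (\<Sum>L\<in>lines_at x. \<beta>)"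
  proof (rule sum_strict_mono_ex1)
    show "\<forall>L\<in>lines_at x. real (card L) - 1 \<le> \<beta>"
      using clique_card_le line_clique by (force simp: lines_at_def)
    have "real (card L) \<le> \<beta> + 1" "L \<in> lines_at x"
      using L clique_card_le line_clique by (auto simp: bad_lines_def lines_at_def)
    then show "\<exists>L\<in>lines_at x. real (card L) - 1 < \<beta>"
      using L(1) by (intro bexI[of _ L]) (auto simp: bad_lines_def)
  qed simp
  finally show ?thesis using beta_ge_r by simp
qed

lemma card_lines_at_good:
  assumes x: "x \<in> V" and good: "bad_lines = {}"
  shows "real (card (lines_at x)) = r"
proof -
  have "r * \<beta> = (\<Sum>L\<in>lines_at x. real (card L) - 1)" using sum_card_lines_at[OF x] by simp
  also have "\<dots> = (\<Sum>L\<in>lines_at x. \<beta>)"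
    using good by (intro sum.cong) (auto simp: lines_at_def bad_lines_def)
  finally show ?thesis using beta_ge_r by simp
qed

text \<open>The projection \<open>P\<close> onto the eigenspace of \<open>- r\<close> has constant diagonal. An eigenfunction that
  sums to zero on every bad line sums to zero on every line, hence vanishes on the points of bad lines;
  so the trace of \<open>P\<close> over these points is at most the number of bad lines.\<close>

lemma card_bad_points_le: "real (card (\<Union>bad_lines)) \<le> 2 * real (card bad_lines)"
proof -
  let ?C = "\<Sum>i\<le>D. K i * (u i)\<^sup>2"
  let ?B = "\<Union>bad_lines"
  have C: "?C > 0" "?C \<le> 2" using cosine_kernel_norm_pos[OF cosine_u] kernel_norm_le by auto
  define P where "P x y = u (d x y) / ?C" for x y
  define ind where "ind L y = (if y \<in> L then 1 else 0 :: real)" for L :: "'a set" and y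
  have fin: "finite bad_lines" using finite_lines by (simp add: bad_lines_def)
  have BV: "?B \<subseteq> V" using line_clique by (auto simp: bad_lines_def is_clique_def)
  have sum_ind: "(\<Sum>y\<in>V. g y * ind L y) = (\<Sum>y\<in>L. g y)" if "L \<in> lines" for g L
    using line_clique[OF that] by (intro sum.mono_neutral_cong_right) (auto simp: ind_def is_clique_def)
  have PP: "(\<Sum>z\<in>V. P x z * P z y) = P x y" if "x \<in> V" "y \<in> V" for x y
    using cosine_kernel_square[OF cosine_u that] C
    by (simp add: P_def flip: sum_divide_distrib)
  have Psym: "P x y = P y x" for x y by (simp add: P_def d_sym)
  obtain R where Rsym: "\<And>x y. x \<in> V \<Longrightarrow> y \<in> V \<Longrightarrow> R x y = R y x"
    and PR: "\<And>x y. x \<in> V \<Longrightarrow> y \<in> V \<Longrightarrow> (\<Sum>z\<in>V. P x z * R z y) = R x y"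
    and RF: "\<And>L x. L \<in> bad_lines \<Longrightarrow> x \<in> V \<Longrightarrow> (\<Sum>y\<in>V. R x y * ind L y) = 0"
    and tr: "(\<Sum>x\<in>?B. R x x) \<ge> (\<Sum>x\<in>?B. P x x) - real (card (ind ` bad_lines))"
    using projection_deflation[OF finite_V BV finite_imageI[OF fin, of ind], of P, OF Psym PP] by blast
  have "R x z = 0" if x: "x \<in> ?B" and z: "z \<in> V" for x z
  proof -
    have xV: "x \<in> V" using x BV by auto
    define \<psi> where "\<psi> y = R y z" for y
    \<comment> \<open>\<open>\<psi>\<close> is fixed by \<open>P\<close>, whose columns are
      eigenfunctions for \<open>- r\<close>.\<close>
    have eig: "(\<Sum>y\<in>N x. \<psi> y) = - r * \<psi> x"
    proof -
      have "(\<Sum>y\<in>N x. \<psi> y) = (\<Sum>y\<in>N x. \<Sum>v\<in>V. P y v * \<psi> v)"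
        using PR z by (intro sum.cong refl) (simp add: \<psi>_def in_N)
      also have "\<dots> = (\<Sum>v\<in>V. \<Sum>y\<in>N x. P y v * \<psi> v)" by (rule sum.swap)
      also have "\<dots> = (\<Sum>v\<in>V. (\<Sum>y\<in>N x. u (d v y)) * \<psi> v / ?C)"
        by (simp add: P_def d_sym sum_distrib_right sum_divide_distrib)
      also have "\<dots> = (\<Sum>v\<in>V. - r * (P x v * \<psi> v))"
        using eigenfun_cosine[OF cosine_u] xV
        by (intro sum.cong refl) (simp add: eigenfun_def P_def d_sym)
      also have "\<dots> = - r * \<psi> x" unfolding sum_distrib_left[symmetric] using PR[OF xV z] by (simp add: \<psi>_def)
      finally show ?thesis .
    qed
    have "(\<Sum>y\<in>L. \<psi> y) = 0" if L: "L \<in> lines" for L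
    proof (cases "L \<in> bad_lines")
      case True
      have "(\<Sum>y\<in>L. \<psi> y) = (\<Sum>y\<in>V. \<psi> y * ind L y)" using sum_ind[OF L] by simp
      also have "\<dots> = (\<Sum>y\<in>V. R z y * ind L y)"
        using Rsym z by (intro sum.cong refl) (simp add: \<psi>_def)
      finally show ?thesis using RF[OF True z] by simp
    next
      case False
      then have cL: "real (card L) = \<beta> + 1" using L by (simp add: bad_lines_def)
      have LV: "L \<subseteq> V" using line_clique[OF L] by (simp add: is_clique_def)
      have "(\<Sum>y\<in>L. \<psi> y) = (\<Sum>y\<in>L. \<Sum>v\<in>V. P y v * \<psi> v)"
        using PR z LV by (intro sum.cong refl) (auto simp: \<psi>_def)
      also have "\<dots> = (\<Sum>v\<in>V. \<Sum>y\<in>L. P y v * \<psi> v)" by (rule sum.swap)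
      also have "\<dots> = (\<Sum>v\<in>V. (\<Sum>y\<in>L. u (d v y)) * \<psi> v / ?C)"
        by (simp add: P_def d_sym sum_distrib_right sum_divide_distrib)
      also have "\<dots> = 0" using delsarte_clique_kernel[OF line_clique[OF L] cL] by simp
      finally show ?thesis .
    qed
    then have "(\<Sum>L\<in>lines_at x. \<Sum>y\<in>L. \<psi> y) = 0" by (simp add: lines_at_def)
    \<comment> \<open>The line sums through \<open>x\<close> add up to
      \<open>card (lines_at x) * \<psi> x\<close> plus the neighbour sum
      \<open>- r * \<psi> x\<close>.\<close>
    then have "(real (card (lines_at x)) - r) * \<psi> x = 0"
      using sum_lines_at[OF xV, of \<psi>] eig by (simp add: algebra_simps)
    moreover have "real (card (lines_at x)) > r" using x card_lines_at_bad by auto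
    ultimately show ?thesis by (simp add: \<psi>_def)
  qed
  then have "(\<Sum>x\<in>?B. R x x) = 0" using BV by (intro sum.neutral) auto
  \<comment> \<open>The diagonal entries are \<open>u 0 / ?C\<close>; the factor 2 of the claim
    comes from \<open>?C \<le> 2\<close>.\<close>
  moreover have "(\<Sum>x\<in>?B. P x x) = real (card ?B) / ?C" by (simp add: P_def)
  ultimately have "real (card ?B) / ?C \<le> real (card (ind ` bad_lines))" using tr by simp
  also have "\<dots> \<le> real (card bad_lines)" using fin by (simp add: card_image_le)
  finally have "real (card ?B) \<le> real (card bad_lines) * ?C" using C by (simp add: pos_divide_le_eq)
  also have "\<dots> \<le> real (card bad_lines) * 2" using C by (intro mult_left_mono) auto
  finally show ?thesis by simp
qed

text \<open>Count incidences of points with bad lines. Such a line has more than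
  \<open>q * \<beta> / (q + 1)\<close> points, a point is on at most \<open>(q + 1) * r / q\<close>
  lines, and there are at most two points per bad line. So
  \<open>q\<^sup>2 * \<beta> \<le> 2 * (q + 1)\<^sup>2 * r\<close>, which contradicts
  \<open>beta_bound\<close> as \<open>q * \<mu> \<ge> 4\<close>.\<close>

lemma no_bad_lines: "bad_lines = {}"
proof (rule ccontr)
  let ?B = "\<Union>bad_lines"
  assume "bad_lines \<noteq> {}"
  moreover have fin: "finite bad_lines" using finite_lines by (simp add: bad_lines_def)
  ultimately have pos: "real (card bad_lines) > 0" by (simp add: card_gt_0_iff)
  have BV: "?B \<subseteq> V" using line_clique by (auto simp: bad_lines_def is_clique_def)
  have finB: "finite ?B" using BV finite_V finite_subset by blast
  have "(\<Sum>L\<in>bad_lines. real (card L)) = (\<Sum>L\<in>bad_lines. \<Sum>x\<in>?B. if x \<in> L then 1 else 0)"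
  proof (rule sum.cong[OF refl])
    fix L assume "L \<in> bad_lines"
    then have "?B \<inter> L = L" by auto
    then show "real (card L) = (\<Sum>x\<in>?B. if x \<in> L then 1 else 0)"
      using finB by (simp add: sum.If_cases Int_def)
  qed
  also have "\<dots> = (\<Sum>x\<in>?B. \<Sum>L\<in>bad_lines. if x \<in> L then 1 else 0)" by (rule sum.swap)
  also have "\<dots> \<le> (\<Sum>x\<in>?B. real (card (lines_at x)))"
  proof (rule sum_mono)
    fix x
    have "(\<Sum>L\<in>bad_lines. if x \<in> L then 1 else 0) = real (card {L \<in> bad_lines. x \<in> L})"
      using fin by (simp add: sum.If_cases Int_def)
    also have "\<dots> \<le> real (card (lines_at x))"
      using finite_lines by (intro of_nat_mono card_mono) (auto simp: bad_lines_def lines_at_def)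
    finally show "(\<Sum>L\<in>bad_lines. if x \<in> L then 1 else 0) \<le> real (card (lines_at x))" .
  qed
  finally have "q * (q + 1) * (\<Sum>L\<in>bad_lines. real (card L)) \<le> q * (q + 1) * (\<Sum>x\<in>?B. real (card (lines_at x)))"
    using q_ge by (intro mult_left_mono) auto
  also have "\<dots> = (q + 1) * (\<Sum>x\<in>?B. q * real (card (lines_at x)))"
    by (simp add: sum_distrib_left mult_ac)
  also have "\<dots> \<le> (q + 1) * (\<Sum>x\<in>?B. (q + 1) * r)"
    using card_lines_at_le BV q_ge by (intro mult_left_mono sum_mono) auto
  also have "\<dots> = (q + 1)\<^sup>2 * r * real (card ?B)" by (simp add: power2_eq_square mult_ac)
  also have "\<dots> \<le> (q + 1)\<^sup>2 * r * (2 * real (card bad_lines))"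
    using card_bad_points_le r_ge_q by (intro mult_left_mono) auto
  finally have up: "q * (q + 1) * (\<Sum>L\<in>bad_lines. real (card L)) \<le> 2 * (q + 1)\<^sup>2 * r * real (card bad_lines)"
    by (simp add: mult_ac)
  have "q * (\<Sum>L\<in>bad_lines. q * \<beta>) \<le> q * (\<Sum>L\<in>bad_lines. (q + 1) * real (card L))"
  proof (intro mult_left_mono sum_mono)
    fix L assume "L \<in> bad_lines"
    then have "q * \<beta> < (q + 1) * (real (card L) - 1)" using line_card by (auto simp: bad_lines_def)
    then show "q * \<beta> \<le> (q + 1) * real (card L)" using q_ge by (simp add: algebra_simps)
  qed (use q_ge in auto)
  also have "\<dots> = q * (q + 1) * (\<Sum>L\<in>bad_lines. real (card L))" by (simp add: sum_distrib_left mult_ac)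
  finally have "(q * (q * \<beta>)) * real (card bad_lines) \<le> (2 * (q + 1)\<^sup>2 * r) * real (card bad_lines)"
    using up by (simp add: mult_ac)
  then have 1: "q * (q * \<beta>) \<le> 2 * ((q + 1)\<^sup>2 * r)" using pos by (simp add: mult.assoc)
  have p: "(q + 1)\<^sup>2 * r > 0" using q_ge r_ge_q by (intro mult_pos_pos) auto
  have "4 * ((q + 1)\<^sup>2 * r) \<le> q * \<mu> * ((q + 1)\<^sup>2 * r)"
  proof (rule mult_right_mono)
    have "2 * 2 \<le> q * \<mu>" using q_ge mu_ge by (intro mult_mono) auto
    then show "4 \<le> q * \<mu>" by simp
  qed (use p in simp)
  also have "\<dots> = q * (r * \<mu> * (q + 1)\<^sup>2)" by (simp only: mult_ac)
  also have "\<dots> \<le> q * (q * \<beta>)" using beta_bound q_ge by (intro mult_left_mono) auto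
  finally show False using 1 p by simp
qed

section \<open>The smallest eigenvalue and the conclusion\<close>

lemma theta_min_eq: "theta_min V E = - r"
  unfolding theta_min_def
proof (rule Min_eqI)
  show "finite {\<theta>. adj_eigenvalue V E \<theta>}" by (rule finite_eigenvalues)
  obtain x where x: "x \<in> V" using V_nonempty by auto
  have "eigenfun (- r) (\<lambda>y. u (d x y))" using cosine_u x by (rule eigenfun_cosine)
  then show "- r \<in> {\<theta>. adj_eigenvalue V E \<theta>}"
    using x by (auto simp: adj_eigenvalue_def eigenfun_def intro!: exI[of _ "\<lambda>y. u (d x y)"] bexI[of _ x])
next
  fix \<theta> assume "\<theta> \<in> {\<theta>. adj_eigenvalue V E \<theta>}"
  then obtain f x where f: "x \<in> V" "f x \<noteq> 0" "\<And>x. x \<in> V \<Longrightarrow> (\<Sum>y\<in>N x. f y) = \<theta> * f x"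
    by (auto simp: adj_eigenvalue_def)
  have LV: "L \<subseteq> V" if "L \<in> lines" for L using line_clique[OF that] by (simp add: is_clique_def)
  \<comment> \<open>This is the form of \<open>A + r I\<close> at \<open>f\<close>: each point lies
    on \<open>r\<close> lines and each edge on one, so for an eigenfunction it equals
    \<open>r + \<theta>\<close> times the squared norm of \<open>f\<close>.\<close>
  have "0 \<le> (\<Sum>L\<in>lines. (\<Sum>y\<in>L. f y)\<^sup>2)" by (intro sum_nonneg) auto
  also have "\<dots> = (\<Sum>L\<in>lines. \<Sum>x\<in>V. if x \<in> L then f x * (\<Sum>y\<in>L. f y) else 0)"
  proof (rule sum.cong[OF refl])
    fix L assume "L \<in> lines"
    then have "{x \<in> V. x \<in> L} = L" using LV by auto
    then show "(\<Sum>y\<in>L. f y)\<^sup>2 = (\<Sum>x\<in>V. if x \<in> L then f x * (\<Sum>y\<in>L. f y) else 0)"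
      by (simp add: power2_eq_square sum_distrib_right flip: sum.inter_filter)
  qed
  also have "\<dots> = (\<Sum>x\<in>V. \<Sum>L\<in>lines. if x \<in> L then f x * (\<Sum>y\<in>L. f y) else 0)" by (rule sum.swap)
  also have "\<dots> = (\<Sum>x\<in>V. f x * (\<Sum>L\<in>lines_at x. \<Sum>y\<in>L. f y))"
    using finite_lines by (simp add: lines_at_def sum_distrib_left flip: sum.inter_filter)
  also have "\<dots> = (\<Sum>x\<in>V. (r + \<theta>) * (f x)\<^sup>2)"
    using sum_lines_at[of _ f] f(3) card_lines_at_good[OF _ no_bad_lines]
    by (intro sum.cong refl) (simp add: power2_eq_square algebra_simps)
  finally have "0 \<le> (r + \<theta>) * (\<Sum>x\<in>V. (f x)\<^sup>2)" by (simp add: sum_distrib_left)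
  moreover have "(\<Sum>x\<in>V. (f x)\<^sup>2) > 0"
    using f(1,2) by (intro sum_pos2[of V x]) auto
  ultimately show "- r \<le> \<theta>" by (simp add: zero_le_mult_iff)
qed

lemma geometric: "geometric V E (bs 0)"
  unfolding geometric_def
proof (intro exI[of _ lines] conjI ballI allI impI)
  fix L assume L: "L \<in> lines"
  \<comment> \<open>The Delsarte size, as the valency \<open>r * \<beta>\<close> divided by
    \<open>r\<close> is \<beta>.\<close>
  then have "real (card L) = 1 + \<beta>" using no_bad_lines by (auto simp: bad_lines_def)
  then show "delsarte_clique V E (bs 0) L"
    using line_clique[OF L] r_ge_q by (simp add: delsarte_clique_def theta_min_eq bs_0)
next
  fix x y assume "adj V E x y"
  then show "\<exists>!L. L \<in> lines \<and> x \<in> L \<and> y \<in> L" by (intro ex1_line) (auto simp: adj_def in_N)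
qed

end

theorem theorem19:
  fixes V :: "'a set" and E :: "'a \<Rightarrow> 'a \<Rightarrow> bool"
    and D :: nat and bs cs :: "nat \<Rightarrow> nat" and b :: int and \<alpha> \<beta> :: real
  assumes "distance_regular V E D bs cs"
    and "classical_parameters D b \<alpha> \<beta> bs cs"
    and "b \<ge> 2" and "D \<ge> 3"
    and "\<beta> \<ge> max ((2 * b + 4) / (2 * b + 3) * qint b D * (b + 2) * (\<alpha> * b + b + \<alpha>))
                 ((2 * b + 4) / (2 * b + 3) * qint b D * ((b + 1) * (b ^ 2 + b + 2) - 3))"
  shows "geometric V E (bs 0)"
proof -
  interpret classical_graph V E D bs cs b \<alpha> \<beta>
    using assms by unfold_locales auto
  have rm: "r * \<mu> \<ge> 0" using r_ge_q mu_ge q_ge by (intro mult_nonneg_nonneg) auto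
  \<comment> \<open>The right side exceeds the left by \<open>q\<^sup>2 - 3\<close>; this turns the
    first bound of the maximum into \<open>beta_bound\<close>.\<close>
  have "(q + 1)\<^sup>2 * (2 * q + 3) \<le> q * ((2 * q + 4) * (q + 2))"
  proof -
    have "2 * 2 \<le> q * q" using q_ge by (intro mult_mono) auto
    then show ?thesis using q_ge by (simp add: power2_eq_square algebra_simps)
  qed
  then have "(q + 1)\<^sup>2 \<le> q * ((2 * q + 4) / (2 * q + 3) * (q + 2))"
    using q_ge by (simp add: pos_le_divide_eq)
  then have "(q + 1)\<^sup>2 * (r * \<mu>) \<le> q * ((2 * q + 4) / (2 * q + 3) * (q + 2)) * (r * \<mu>)"
    using rm by (rule mult_right_mono)
  also have "\<dots> = q * ((2 * q + 4) / (2 * q + 3) * r * (q + 2) * \<mu>)" by (simp only: mult_ac)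
  also have "\<dots> \<le> q * \<beta>"
    using assms(5) q_ge by (intro mult_left_mono) (auto simp: \<mu>_def)
  finally interpret large_classical_graph V E D bs cs b \<alpha> \<beta>
    by unfold_locales (simp add: \<mu>_def mult_ac)
  show ?thesis by (rule geometric)
qed

end
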